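(* Let $1<p<\infty$. Suppose $J$ is an inner function with $J(0)\neq 0$, and suppose that the infimum $$\inf_{h\in H^p}\|1-Jh\|_p$$ is attained at $h=h^*\in H^p$. Then $[Jh^*]_p=[J]_p$ and, in particular, $h^*$ is outer. Moreover, $$\operatorname{dist}_{H^p}(1,[J]_p)=\left(1-|J(0)|^2\right)^{1/p}.$$
   Context: $\mathbb{D}$ is the open unit disk, $\mathbb{T}$ the unit circle. $H^p$ is the Hardy space of analytic functions on $\mathbb{D}$ with norm $\|f\|_p^p=\sup_{0<r<1}\frac1{2\pi}\int_0^{2\pi}|f(re^{i\theta})|^p\,d\theta$. A function in $H^\infty$ is inner if its boundary values have modulus $1$ a.e. on $\mathbb{T}$. For $f\in H^p$, $[f]_p$ is the closure in $H^p$ of $\operatorname{span}\{z^kf:k=0,1,2,\dots\}$. $\operatorname{dist}_{H^p}(1,M)=\inf_{g\in M}\|1-g\|_p$. *)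

theory Defs
  imports "HOL-Complex_Analysis.Complex_Analysis" "HOL-Library.Function_Algebras"
begin

text \<open>
  Functions on the open unit disk are total functions on the complex plane of which only the values
  on \<open>ball 0 1\<close> matter: a function belongs to one of the sets below, or has one of the properties
  below, depending only on its restriction to the disk.
\<close>

definition hardy_mean :: "real \<Rightarrow> (complex \<Rightarrow> complex) \<Rightarrow> real \<Rightarrow> real" where
  "hardy_mean p f r =
     1 / (2 * pi) * integral {0..2 * pi} (\<lambda>t. cmod (f (of_real r * cis t)) powr p)"

definition hardy_space :: "real \<Rightarrow> (complex \<Rightarrow> complex) set" where
  "hardy_space p = {f. f holomorphic_on ball 0 1 \<and> bdd_above (hardy_mean p f ` {0<..<1})}"

text \<open>Meaningful only on \<open>hardy_space p\<close>, where the supremum is over a bounded set.\<close>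

definition hardy_norm :: "real \<Rightarrow> (complex \<Rightarrow> complex) \<Rightarrow> real" where
  "hardy_norm p f = (SUP r\<in>{0<..<1}. hardy_mean p f r) powr (1 / p)"

definition hardy_dist :: "real \<Rightarrow> (complex \<Rightarrow> complex) \<Rightarrow> (complex \<Rightarrow> complex) set \<Rightarrow> real" where
  "hardy_dist p f M = (INF g\<in>M. hardy_norm p (\<lambda>z. f z - g z))"

definition hardy_closure :: "real \<Rightarrow> (complex \<Rightarrow> complex) set \<Rightarrow> (complex \<Rightarrow> complex) set" where
  "hardy_closure p M =
     {f \<in> hardy_space p. \<forall>e>0. \<exists>g\<in>M. hardy_norm p (\<lambda>z. f z - g z) < e}"

interpretation complex_fun: vector_space "\<lambda>(c::complex) (f::complex \<Rightarrow> complex) z. c * f z"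
  by unfold_locales (auto simp: fun_eq_iff algebra_simps)

definition shift_invariant_hull :: "real \<Rightarrow> (complex \<Rightarrow> complex) \<Rightarrow> (complex \<Rightarrow> complex) set" where
  "shift_invariant_hull p f =
     hardy_closure p (complex_fun.span (range (\<lambda>k::nat. \<lambda>z. z ^ k * f z)))"

definition hardy_infinity :: "(complex \<Rightarrow> complex) set" where
  "hardy_infinity = {f. f holomorphic_on ball 0 1 \<and> bounded (f ` ball 0 1)}"

text \<open>The boundary value of \<open>f\<close> at \<open>cis t\<close> is its radial limit there.\<close>

definition has_boundary_value :: "(complex \<Rightarrow> complex) \<Rightarrow> real \<Rightarrow> complex \<Rightarrow> bool" where
  "has_boundary_value f t w \<longleftrightarrow> ((\<lambda>r. f (of_real r * cis t)) \<longlongrightarrow> w) (at_left (1::real))"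

definition inner_function :: "(complex \<Rightarrow> complex) \<Rightarrow> bool" where
  "inner_function f \<longleftrightarrow> f \<in> hardy_infinity \<and>
     (AE t in lebesgue_on {0..2 * pi}. \<exists>w. has_boundary_value f t w \<and> cmod w = 1)"

text \<open>
  The classical definition: a unimodular constant times the exponential of the Herglotz integral
  of \<open>ln \<phi>\<close>, where \<open>\<phi>\<close> is a positive measurable function on the circle with integrable logarithm.
\<close>

definition outer_function :: "(complex \<Rightarrow> complex) \<Rightarrow> bool" where
  "outer_function f \<longleftrightarrow>
     (\<exists>c (\<phi> :: real \<Rightarrow> real). cmod c = 1 \<and>
        \<phi> \<in> borel_measurable lebesgue \<and> (\<forall>t. \<phi> t > 0) \<and>
        (\<lambda>t. ln (\<phi> t)) absolutely_integrable_on {0..2 * pi} \<and>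
        (\<forall>z\<in>ball 0 1.
           f z = c * exp (1 / (2 * pi) *
             integral {0..2 * pi} (\<lambda>t. (cis t + z) / (cis t - z) * of_real (ln (\<phi> t))))))"

end

theory Submission
  imports Defs
begin

text \<open>
Write \<open>a = J 0\<close>, \<open>W = (cmod (1 - cnj a * J))\<^sup>2\<close>, and \<open>d\<close> for the claimed distance. The point is
that the minimiser is explicit. When \<open>cmod a < 1\<close> it is the function \<open>h\<close> with
\<open>1 - J h = F = (1 - cnj a J) powr (2 / p)\<close>, so that \<open>\<bar>F\<bar>\<^sup>p = W\<close>. For \<open>p = 2\<close> this is
\<open>1\<close> minus its orthogonal projection onto \<open>J H\<^sup>2\<close>; the exponent \<open>2 / p\<close> makes \<open>\<bar>F\<bar>\<^sup>p\<close>
independent of \<open>p\<close>.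
The mean of \<open>W\<close> over a circle is \<open>1 - 2 \<bar>a\<bar>\<^sup>2 + \<bar>a\<bar>\<^sup>2 * (mean of \<bar>J\<bar>\<^sup>2)\<close>, which is
at most \<open>1 - \<bar>a\<bar>\<^sup>2\<close> and tends to it at the boundary.

Optimality: for \<open>k\<close> in \<open>H\<^sup>p\<close> put \<open>w = J k / F\<close>. Then
\<open>\<bar>F - J k\<bar>\<^sup>p = W * \<bar>1 - w\<bar>\<^sup>p = W * (1 - p * Re w + tangent_gap p w)\<close> with a nonnegative last
term. With \<open>K = (1 - cnj a J) / F\<close> we have \<open>W w = K (J - a) k + a K (1 - \<bar>J\<bar>\<^sup>2) k\<close>. The first
summand is holomorphic and vanishes at \<open>0\<close>, so all its circle means are zero; the means of the
second tend to zero since \<open>\<bar>J\<bar> \<rightarrow> 1\<close> radially almost everywhere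
(\<open>dual_extremal_annihilates\<close>). Hence the norm of \<open>F - J k\<close> is at least \<open>d\<close>. If it equals
\<open>d\<close>, the means of \<open>W * tangent_gap p w\<close> tend to zero; as \<open>tangent_gap\<close> controls \<open>\<bar>w\<bar>\<close>, Cauchy's
formula gives \<open>w = 0\<close>. So the minimiser is unique on the disk. All estimates are made on circles of
radius less than \<open>1\<close>, where \<open>k\<close> is continuous, before the radius tends to \<open>1\<close>.

Consequences: \<open>(1 - (1 - cnj a w) powr (2 / p)) / w\<close> is holomorphic and zero-free on a half-plane
containing the closed disk, hence equal to \<open>exp (U w)\<close> there (\<open>extremal_generator\<close>). The minimiser is thus
\<open>exp (U \<circ> J)\<close> with \<open>U \<circ> J\<close> bounded and radial limits almost everywhere. Herglotz's formula for
\<open>U \<circ> J\<close> shows that it is outer. Moreover \<open>J h\<close> and \<open>J\<close> differ by the factors \<open>exp (U \<circ> J)\<close>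
and \<open>exp (- U \<circ> J)\<close>, both of which are \<open>p\<close>-mean limits of polynomials, so they generate
the same invariant subspace. Finally, elements of the hull of \<open>J\<close> are limits of \<open>J P\<close> with \<open>P\<close> a
polynomial, for which the lower bound \<open>d\<close> is already known, and \<open>J h\<close> attains it.

If \<open>cmod a = 1\<close>, then \<open>J\<close> is constant and everything degenerates to \<open>J h = 1\<close> and \<open>d = 0\<close>.
\<close>

section \<open>Means over circles and Cauchy's formula\<close>

definition circle_mean :: "(complex \<Rightarrow> 'a::euclidean_space) \<Rightarrow> real \<Rightarrow> 'a" where
  "circle_mean F r = (1 / (2 * pi)) *\<^sub>R integral {0..2 * pi} (\<lambda>t. F (of_real r * cis t))"

lemma hardy_mean_eq_circle_mean: "hardy_mean p f r = circle_mean (\<lambda>z. cmod (f z) powr p) r"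
  by (simp add: hardy_mean_def circle_mean_def)

lemma circle_in_ball: "r \<in> {0<..<1} \<Longrightarrow> of_real r * cis t \<in> ball (0::complex) 1"
  by (simp add: norm_mult)

lemma continuous_on_circle:
  assumes "continuous_on (ball 0 1) F" "r \<in> {0<..<1}"
  shows "continuous_on S (\<lambda>t. F (of_real r * cis t))"
  by (rule continuous_on_compose2[OF assms(1)])
     (use assms(2) in \<open>auto intro!: continuous_intros simp: norm_mult\<close>)

lemma circle_integrable:
  assumes "continuous_on (ball 0 1) (F :: complex \<Rightarrow> 'a::euclidean_space)" "r \<in> {0<..<1}"
  shows "(\<lambda>t. F (of_real r * cis t)) integrable_on {0..2 * pi}"
  by (intro integrable_continuous_real continuous_on_circle assms)

lemma circle_mean_add:
  assumes "continuous_on (ball 0 1) F" "continuous_on (ball 0 1) G" "r \<in> {0<..<1}"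
  shows "circle_mean (\<lambda>z. F z + G z) r = circle_mean F r + circle_mean G r"
  unfolding circle_mean_def
  by (subst integral_add) (use assms circle_integrable in \<open>auto simp: scaleR_add_right\<close>)

lemma circle_mean_cmult: "circle_mean (\<lambda>z. c * F z) r = c * circle_mean F r" for c :: real
  unfolding circle_mean_def by simp

lemma circle_mean_const: "circle_mean (\<lambda>z. c) r = c"
  unfolding circle_mean_def by simp

lemma circle_mean_mono:
  fixes F G :: "complex \<Rightarrow> real"
  assumes "continuous_on (ball 0 1) F" "continuous_on (ball 0 1) G" "r \<in> {0<..<1}"
    and "\<And>z. z \<in> ball 0 1 \<Longrightarrow> F z \<le> G z"
  shows "circle_mean F r \<le> circle_mean G r"
  unfolding circle_mean_def real_scaleR_def
  using circle_integrable circle_in_ball assms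
  by (intro mult_left_mono integral_le) auto

lemma circle_mean_cong:
  assumes "r \<in> {0<..<1}" "\<And>z. z \<in> ball 0 1 \<Longrightarrow> F z = G z"
  shows "circle_mean F r = circle_mean G r"
  unfolding circle_mean_def using assms circle_in_ball by simp

lemma circle_mean_Re:
  assumes "continuous_on (ball 0 1) F" "r \<in> {0<..<1}"
  shows "Re (circle_mean F r) = circle_mean (\<lambda>z. Re (F z)) r"
proof -
  have "integral {0..2*pi} (Re \<circ> (\<lambda>t. F (of_real r * cis t))) =
      Re (integral {0..2*pi} (\<lambda>t. F (of_real r * cis t)))"
    by (rule integral_linear[OF circle_integrable[OF assms] bounded_linear_Re])
  then show ?thesis by (simp add: circle_mean_def o_def)
qed

lemma Cauchy_has_integral_circle:
  assumes "f holomorphic_on ball 0 1" "0 < r" "r < 1" "cmod z < r"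
  shows "((\<lambda>t. f (of_real r * cis t) * (of_real r * cis t / (of_real r * cis t - z)))
    has_integral 2 * of_real pi * f z) {0..2 * pi}"
proof -
  have "((\<lambda>u. f u / (u - z)) has_contour_integral 2 * of_real pi * \<i> * f z) (circlepath 0 r)"
    by (rule Cauchy_integral_circlepath_simple)
       (use assms in \<open>auto intro: holomorphic_on_subset\<close>)
  then have "((\<lambda>t. f (0 + of_real r * cis t) / (0 + of_real r * cis t - z) * of_real r * \<i> * cis t)
      has_integral 2 * of_real pi * \<i> * f z) {0..2 * pi}"
    unfolding circlepath_def by (subst (asm) has_contour_integral_part_circlepath_iff) auto
  from has_integral_mult_right[OF this, of "- \<i>"] show ?thesis
    by (simp add: field_simps)
qed

lemma Cauchy_integral_circle_mean:
  assumes "f holomorphic_on ball 0 1" "0 < r" "r < 1" "cmod z < r"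
  shows "circle_mean (\<lambda>w. f w * (w / (w - z))) r = f z"
  using integral_unique[OF Cauchy_has_integral_circle[OF assms]]
  by (simp add: circle_mean_def scaleR_conv_of_real)

lemma mean_value_has_integral:
  assumes "f holomorphic_on ball 0 1" "r \<in> {0<..<1}"
  shows "((\<lambda>t. f (of_real r * cis t)) has_integral 2 * of_real pi * f 0) {0..2 * pi}"
  using Cauchy_has_integral_circle[of f r 0] assms by simp

lemma mean_value_property:
  assumes "f holomorphic_on ball 0 1" "r \<in> {0<..<1}"
  shows "circle_mean f r = f 0"
  using integral_unique[OF mean_value_has_integral[OF assms]]
  by (simp add: circle_mean_def scaleR_conv_of_real)

text \<open>
Cauchy's formula bounds a value by a first mean, uniformly as \<open>r\<close> tends to \<open>1\<close>. This turns
convergence of means into pointwise information inside the disk.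
\<close>

lemma holomorphic_le_circle_mean:
  assumes f: "f holomorphic_on ball 0 1" and r: "0 < r" "r < 1" and z: "cmod z < r"
  shows "(r - cmod z) * cmod (f z) \<le> circle_mean (\<lambda>w. cmod (f w)) r"
proof -
  let ?w = "\<lambda>t. of_real r * cis t"
  have cf: "continuous_on (ball 0 1) f" using f holomorphic_on_imp_continuous_on by blast
  have ne: "?w t - z \<noteq> 0" for t
  proof
    assume "?w t - z = 0"
    then have "cmod z = r" using r by (auto simp: norm_mult dest!: sym[of _ z])
    then show False using z by simp
  qed
  have bd: "r - cmod z \<le> cmod (?w t - z)" for t
    using norm_triangle_ineq2[of "?w t" z] r by (simp add: norm_mult)
  have "cmod (f z) = cmod (circle_mean (\<lambda>w. f w * (w / (w - z))) r)"
    using Cauchy_integral_circle_mean[OF f r z] by simp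
  also have "\<dots> = 1 / (2 * pi) *
      norm (integral {0..2*pi} (\<lambda>t. f (?w t) * (?w t / (?w t - z))))"
    by (simp add: circle_mean_def)
  also have "\<dots> \<le> 1 / (2 * pi) *
      integral {0..2*pi} (\<lambda>t. 1 / (r - cmod z) * cmod (f (?w t)))"
  proof (intro mult_left_mono integral_norm_bound_integral integrable_on_cmult_left)
    show "(\<lambda>t. f (?w t) * (?w t / (?w t - z))) integrable_on {0..2 * pi}"
      using ne r cf by (intro integrable_continuous_real continuous_intros continuous_on_circle) auto
    show "(\<lambda>t. 1 / (r - cmod z) * cmod (f (?w t))) integrable_on {0..2 * pi}"
      using r z cf by (intro integrable_continuous_real continuous_intros continuous_on_circle) auto
    fix t
    have "cmod (?w t / (?w t - z)) \<le> 1 / (r - cmod z)"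
      using bd[of t] r z by (simp add: norm_divide norm_mult frac_le)
    from mult_left_mono[OF this norm_ge_zero[of "f (?w t)"]]
    show "norm (f (?w t) * (?w t / (?w t - z))) \<le> 1 / (r - cmod z) * cmod (f (?w t))"
      by (simp only: norm_mult mult.commute)
  qed auto
  also have "\<dots> = circle_mean (\<lambda>w. cmod (f w)) r / (r - cmod z)"
    by (simp add: circle_mean_def)
  finally show ?thesis using z by (simp add: field_simps)
qed

text \<open>
Radial limits exist only almost everywhere, whereas all circle integrals are gauge integrals. This
form of dominated convergence transfers between the two.
\<close>

lemma dominated_convergence_AE_interval:
  fixes f :: "nat \<Rightarrow> real \<Rightarrow> 'a::euclidean_space"
  assumes cont: "\<And>n. continuous_on {a..b} (f n)"
    and bound: "\<And>n t. t \<in> {a..b} \<Longrightarrow> norm (f n t) \<le> C"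
    and meas: "g \<in> borel_measurable (lebesgue_on {a..b})"
    and lim: "AE t in lebesgue_on {a..b}. (\<lambda>n. f n t) \<longlonglongrightarrow> g t"
  shows "integrable (lebesgue_on {a..b}) g"
    and "(\<lambda>n. integral {a..b} (f n)) \<longlonglongrightarrow> integral {a..b} g"
proof -
  have fm: "f n \<in> borel_measurable (lebesgue_on {a..b})" for n
    by (rule continuous_imp_measurable_on_sets_lebesgue[OF cont]) auto
  have C: "integrable (lebesgue_on {a..b}) (\<lambda>t. C)"
    by (intro finite_measure.integrable_const finite_measure_lebesgue_on) auto
  have b: "AE t in lebesgue_on {a..b}. norm (f n t) \<le> C" for n
    using bound by (auto intro!: AE_I2)
  show g: "integrable (lebesgue_on {a..b}) g"
    by (rule integrable_dominated_convergence[OF meas fm C lim b])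
  have fi: "integrable (lebesgue_on {a..b}) (f n)" for n
    by (rule Bochner_Integration.integrable_bound[OF C fm]) (use b[of n] in \<open>auto\<close>)
  have "(\<lambda>n. integral\<^sup>L (lebesgue_on {a..b}) (f n)) \<longlonglongrightarrow> integral\<^sup>L (lebesgue_on {a..b}) g"
    by (rule integral_dominated_convergence[OF meas fm C lim b])
  then show "(\<lambda>n. integral {a..b} (f n)) \<longlonglongrightarrow> integral {a..b} g"
    by (simp add: lebesgue_integral_eq_integral fi g)
qed

lemma circle_mean_tendsto_const:
  fixes F :: "complex \<Rightarrow> 'a::euclidean_space"
  assumes cont: "continuous_on (ball 0 1) F"
    and bound: "\<And>z. z \<in> ball 0 1 \<Longrightarrow> norm (F z) \<le> C"
    and s: "\<And>n. s n \<in> {0<..<1}"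
    and lim: "AE t in lebesgue_on {0..2 * pi}. (\<lambda>n. F (of_real (s n) * cis t)) \<longlonglongrightarrow> c"
  shows "(\<lambda>n. circle_mean F (s n)) \<longlonglongrightarrow> c"
proof -
  have "(\<lambda>n. integral {0..2 * pi} (\<lambda>t. F (of_real (s n) * cis t))) \<longlonglongrightarrow> integral {0..2 * pi} (\<lambda>t. c)"
    by (rule dominated_convergence_AE_interval(2)[where C = C])
       (use s circle_in_ball bound lim in \<open>auto intro!: continuous_on_circle cont\<close>)
  from tendsto_scaleR[OF tendsto_const[of "1 / (2 * pi)"] this]
  show ?thesis by (simp add: circle_mean_def)
qed

lemma has_boundary_value_sequence:
  assumes "has_boundary_value f t w" "s \<longlonglongrightarrow> 1" "\<And>n. s n < 1"
  shows "(\<lambda>n. f (of_real (s n) * cis t)) \<longlonglongrightarrow> w"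
proof -
  have "filterlim s (at_left 1) sequentially"
    using assms(2,3) by (auto simp: filterlim_at less_imp_neq)
  then show ?thesis
    using assms(1) filterlim_compose unfolding has_boundary_value_def by blast
qed

definition radius :: "nat \<Rightarrow> real" where "radius n = 1 - 1 / (real n + 2)"

lemma radius_in: "radius n \<in> {0<..<1}" by (simp add: radius_def)

lemma radius_tendsto: "radius \<longlonglongrightarrow> 1" 
  unfolding radius_def by real_asymp

section \<open>Convexity of powers\<close>

lemma powr_gt_tangent:
  fixes p x :: real
  assumes p: "1 < p" and x: "0 \<le> x" "x \<noteq> 1"
  shows "1 + p * (x - 1) < x powr p"
proof -
  have d: "((\<lambda>x. x powr p) has_real_derivative p * y powr (p - 1)) (at y)" if "0 < y" for y
    using that by (auto intro!: derivative_eq_intros)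
  consider "x = 0" | "0 < x" "x < 1" | "1 < x" using x by linarith
  then show ?thesis
  proof cases
    case 1 then show ?thesis using p by simp
  next
    case 2
    obtain y where y: "x < y" "y < 1" "1 powr p - x powr p = (1 - x) * (p * y powr (p - 1))"
      using MVT2[of x 1 "\<lambda>x. x powr p" "\<lambda>y. p * y powr (p - 1)"] 2 d by auto
    have "y powr (p - 1) < 1" using powr_less_mono2[of "p-1" y 1] p y 2 by simp
    then have "(1 - x) * (p * y powr (p - 1)) < (1 - x) * (p * 1)"
      using p 2 by (intro mult_strict_left_mono) auto
    then show ?thesis using y by (simp add: algebra_simps)
  next
    case 3
    obtain y where y: "1 < y" "y < x" "x powr p - 1 powr p = (x - 1) * (p * y powr (p - 1))"
      using MVT2[of 1 x "\<lambda>x. x powr p" "\<lambda>y. p * y powr (p - 1)"] 3 d by auto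
    have "1 < y powr (p - 1)" using powr_less_mono2[of "p-1" 1 y] p y by simp
    then have "(x - 1) * (p * 1) < (x - 1) * (p * y powr (p - 1))"
      using p 3 by (intro mult_strict_left_mono) auto
    then show ?thesis using y by (simp add: algebra_simps)
  qed
qed

lemma powr_ge_tangent: "1 < p \<Longrightarrow> 0 \<le> x \<Longrightarrow> 1 + p * (x - 1) \<le> x powr p" for p x :: real
  using powr_gt_tangent[of p x] by (cases "x = 1") auto

text \<open>
Both points are compared with the tangent line at their convex combination.
\<close>

lemma powr_convex_combination:
  fixes p a b l :: real
  assumes p: "1 < p" and ab: "0 \<le> a" "0 \<le> b" and l: "0 < l" "l < 1"
  shows "(l * a + (1 - l) * b) powr p \<le> l * a powr p + (1 - l) * b powr p"
proof (cases "l * a + (1 - l) * b = 0")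
  case True
  then show ?thesis using l ab by simp
next
  case False
  define m where "m = l * a + (1 - l) * b"
  have m: "0 < m" using False ab l unfolding m_def 
    by (metis add_nonneg_nonneg diff_gt_0_iff_gt less_eq_real_def mult_nonneg_nonneg)
  have t: "1 + p * (c / m - 1) \<le> c powr p / m powr p" if "0 \<le> c" for c
    using powr_ge_tangent[OF p, of "c / m"] that m by (simp add: powr_divide)
  have "l * (1 + p * (a / m - 1)) + (1 - l) * (1 + p * (b / m - 1))
      \<le> l * (a powr p / m powr p) + (1 - l) * (b powr p / m powr p)"
    using t[OF ab(1)] t[OF ab(2)] l by (intro add_mono mult_left_mono) auto
  also have "l * (1 + p * (a / m - 1)) + (1 - l) * (1 + p * (b / m - 1)) =
      1 + p * ((l * a + (1 - l) * b) / m - 1)"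
    by (simp add: add_divide_distrib diff_divide_distrib algebra_simps)
  also have "\<dots> = 1" using m by (simp add: m_def)
  finally have "1 \<le> (l * a powr p + (1 - l) * b powr p) / m powr p"
    by (simp add: add_divide_distrib)
  then show ?thesis using m by (simp add: m_def)
qed

text \<open>
Convexity applied to \<open>(A + B) * (A / (A + B) * (\<bar>x\<bar> / A) + B / (A + B) * (\<bar>y\<bar> / B))\<close>. When \<open>A\<close> and
\<open>B\<close> bound the norms of two functions, taking means of this inequality gives Minkowski's inequality
on each circle, with bounds that survive the supremum over the radius.
\<close>

lemma Minkowski_pointwise:
  fixes x y :: "'a::real_normed_vector" and p A B :: real
  assumes p: "1 < p" and AB: "0 < A" "0 < B"
  shows "norm (x + y) powr p \<le>
    (A + B) powr p * (A / (A + B) * (norm x powr p / A powr p) + B / (A + B) * (norm y powr p / B powr p))"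
proof -
  define l where "l = A / (A + B)"
  have l: "0 < l" "l < 1" and l': "1 - l = B / (A + B)" using AB by (auto simp: l_def field_simps)
  have e: "(A + B) * (l * (norm x / A) + (1 - l) * (norm y / B)) = norm x + norm y"
    using AB unfolding l' unfolding l_def distrib_left by simp
  have "norm (x + y) powr p \<le> (norm x + norm y) powr p"
    using p by (intro powr_mono2 norm_triangle_ineq) auto
  also have "\<dots> = (A + B) powr p * (l * (norm x / A) + (1 - l) * (norm y / B)) powr p"
    using AB l unfolding e[symmetric] by (subst powr_mult) auto
  also have "\<dots> \<le> (A + B) powr p * (l * (norm x / A) powr p + (1 - l) * (norm y / B) powr p)"
    using AB l p by (intro mult_left_mono powr_convex_combination) auto
  finally show ?thesis
    using AB unfolding l' by (simp add: l_def powr_divide)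
qed

lemma continuous_on_cmod_powr:
  "continuous_on S f \<Longrightarrow> 0 < p \<Longrightarrow> continuous_on S (\<lambda>z. cmod (f z) powr p)"
  by (intro continuous_on_powr' continuous_intros) auto

text \<open>
The gap between \<open>\<bar>1 - w\<bar>\<^sup>p\<close> and its tangent plane at \<open>w = 0\<close>.
\<close>

definition tangent_gap :: "real \<Rightarrow> complex \<Rightarrow> real" where
  "tangent_gap p w = cmod (1 - w) powr p - 1 + p * Re w"

lemma tangent_gap_nonneg:
  assumes p: "1 < p"
  shows "0 \<le> tangent_gap p w"
proof -
  have "1 + p * (cmod (1 - w) - 1) \<le> cmod (1 - w) powr p"
    by (rule powr_ge_tangent[OF p]) simp
  moreover have "p * (1 - Re w) \<le> p * cmod (1 - w)"
    using complex_Re_le_cmod[of "1 - w"] p by (intro mult_left_mono) auto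
  ultimately show ?thesis by (simp add: tangent_gap_def algebra_simps)
qed

text \<open>
If \<open>\<bar>1 - w\<bar> \<noteq> 1\<close>, the strict tangent inequality for the power applies; if \<open>\<bar>1 - w\<bar> = 1\<close>, then
\<open>2 * Re w = \<bar>w\<bar>\<^sup>2\<close>, so already the linear term is positive.
\<close>

lemma tangent_gap_pos:
  assumes p: "1 < p" and w: "w \<noteq> 0"
  shows "0 < tangent_gap p w"
proof (cases "cmod (1 - w) = 1")
  case False
  have "1 + p * (cmod (1 - w) - 1) < cmod (1 - w) powr p"
    by (rule powr_gt_tangent[OF p]) (use False in auto)
  moreover have "p * (1 - Re w) \<le> p * cmod (1 - w)"
    using complex_Re_le_cmod[of "1 - w"] p by (intro mult_left_mono) auto
  ultimately show ?thesis by (simp add: tangent_gap_def algebra_simps)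
next
  case True
  then have "(1 - Re w)\<^sup>2 + (Im w)\<^sup>2 = 1" using cmod_power2[of "1 - w"] by simp
  then have "2 * Re w = (Re w)\<^sup>2 + (Im w)\<^sup>2" by (simp add: power2_eq_square algebra_simps)
  moreover have "0 < (Re w)\<^sup>2 + (Im w)\<^sup>2" using w by (simp add: complex_neq_0)
  ultimately have "0 < Re w" by linarith
  then show ?thesis using True p by (simp add: tangent_gap_def)
qed

lemma tangent_gap_scale:
  assumes p: "1 < p" and l: "0 < l" "l \<le> 1"
  shows "tangent_gap p (of_real l * w) \<le> l * tangent_gap p w"
proof (cases "l = 1")
  case False
  then have l1: "l < 1" using l by simp
  have "1 - of_real l * w = of_real l * (1 - w) + of_real (1 - l)" by (simp add: algebra_simps)
  then have "cmod (1 - of_real l * w) \<le> l * cmod (1 - w) + (1 - l) * 1"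
    using norm_triangle_ineq[of "of_real l * (1 - w)" "of_real (1 - l)"] l l1
    by (simp only: norm_mult norm_of_real) simp
  then have "cmod (1 - of_real l * w) powr p \<le> (l * cmod (1 - w) + (1 - l) * 1) powr p"
    using p by (intro powr_mono2) auto
  also have "\<dots> \<le> l * cmod (1 - w) powr p + (1 - l) * 1 powr p"
    by (rule powr_convex_combination[OF p]) (use l l1 in auto)
  finally show ?thesis by (simp add: tangent_gap_def algebra_simps)
qed simp

lemma continuous_on_tangent_gap:
  "continuous_on S f \<Longrightarrow> 0 < p \<Longrightarrow> continuous_on S (\<lambda>z. tangent_gap p (f z))"
  unfolding tangent_gap_def by (intro continuous_on_cmod_powr continuous_intros) auto

text \<open>
The gap has a positive minimum on the circle of radius \<open>\<delta>\<close>, and by convexity along rays it grows at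
least linearly outside that circle. Hence a small mean gap forces a small first mean, for every
\<open>p > 1\<close>.
\<close>

lemma norm_le_tangent_gap:
  assumes p: "1 < p" and \<delta>: "0 < \<delta>"
  obtains C where "0 \<le> C" "\<And>w. cmod w \<le> \<delta> + C * tangent_gap p w"
proof -
  have "sphere (0::complex) \<delta> \<noteq> {}" using \<delta> by simp
  moreover have "continuous_on (sphere 0 \<delta>) (tangent_gap p)"
    using continuous_on_tangent_gap[OF continuous_on_id] p by simp
  ultimately obtain x where x: "x \<in> sphere 0 \<delta>"
    and min: "\<And>y. y \<in> sphere 0 \<delta> \<Longrightarrow> tangent_gap p x \<le> tangent_gap p y"
    using continuous_attains_inf[OF compact_sphere] by metis
  define m where "m = tangent_gap p x"
  have m: "0 < m" unfolding m_def using x \<delta> by (intro tangent_gap_pos p) auto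
  show thesis
  proof (rule that[of "\<delta> / m"])
    fix w :: complex
    show "cmod w \<le> \<delta> + \<delta> / m * tangent_gap p w"
    proof (cases "cmod w \<le> \<delta>")
      case True
      then show ?thesis using \<delta> m tangent_gap_nonneg[OF p, of w] by (simp add: add_increasing2)
    next
      case False
      define l where "l = \<delta> / cmod w"
      have cw: "\<delta> < cmod w" "0 < cmod w" using False \<delta> by linarith+
      have l: "0 < l" "l \<le> 1" using cw \<delta> by (auto simp: l_def)
      have "cmod (of_real l * w) = \<delta>" using cw \<delta> by (simp add: l_def norm_mult norm_divide)
      then have "m \<le> tangent_gap p (of_real l * w)" unfolding m_def by (intro min) simp
      also have "\<dots> \<le> l * tangent_gap p w" by (rule tangent_gap_scale[OF p l])
      finally have "cmod w \<le> \<delta> / m * tangent_gap p w"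
        using cw \<delta> m by (simp add: l_def field_simps)
      then show ?thesis using \<delta> by simp
    qed
  qed (use \<delta> m in auto)
qed

section \<open>The norm of the Hardy space\<close>

lemma hardy_space_continuous: "f \<in> hardy_space p \<Longrightarrow> continuous_on (ball 0 1) f"
  by (auto simp: hardy_space_def holomorphic_on_imp_continuous_on)

lemma hardy_norm_nonneg: "0 \<le> hardy_norm p f"
  by (simp add: hardy_norm_def)

lemma hardy_mean_nonneg: "0 \<le> hardy_mean p f r"
proof -
  have "0 \<le> integral {0..2 * pi} (\<lambda>t. cmod (f (of_real r * cis t)) powr p)"
    by (cases "(\<lambda>t. cmod (f (of_real r * cis t)) powr p) integrable_on {0..2 * pi}")
       (simp_all add: Henstock_Kurzweil_Integration.integral_nonneg not_integrable_integral)
  then show ?thesis by (simp add: hardy_mean_def)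
qed

lemma hardy_mean_le_norm_powr:
  assumes "0 < p" "f \<in> hardy_space p" "r \<in> {0<..<1}"
  shows "hardy_mean p f r \<le> hardy_norm p f powr p"
proof -
  have le: "hardy_mean p f r \<le> (SUP r\<in>{0<..<1}. hardy_mean p f r)"
    using assms by (intro cSUP_upper) (auto simp: hardy_space_def)
  with hardy_mean_nonneg[of p f r] assms(1) show ?thesis
    by (simp add: hardy_norm_def powr_powr)
qed

lemma hardy_norm_le:
  assumes "0 < p" "0 \<le> A" "\<And>r. r \<in> {0<..<1} \<Longrightarrow> hardy_mean p f r \<le> A powr p"
  shows "hardy_norm p f \<le> A"
proof -
  have n: "0 \<le> (SUP r\<in>{0<..<1}. hardy_mean p f r)"
    by (rule cSUP_upper2[where x = "1/2"])
       (use assms(3) hardy_mean_nonneg in \<open>auto intro!: bdd_aboveI2[where M = "A powr p"]\<close>)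
  have "(SUP r\<in>{0<..<1}. hardy_mean p f r) \<le> A powr p"
    using assms(3) by (intro cSUP_least) auto
  then have "hardy_norm p f \<le> (A powr p) powr (1 / p)"
    unfolding hardy_norm_def using assms n by (intro powr_mono2) auto
  then show ?thesis using assms by (simp add: powr_powr)
qed

lemma hardy_spaceI:
  assumes "f holomorphic_on ball 0 1" "\<And>r. r \<in> {0<..<1} \<Longrightarrow> hardy_mean p f r \<le> C"
  shows "f \<in> hardy_space p"
  using assms by (auto simp: hardy_space_def intro!: bdd_aboveI2[where M = C])

lemma hardy_cong:
  assumes "\<And>z. z \<in> ball 0 1 \<Longrightarrow> f z = g z"
  shows "hardy_norm p f = hardy_norm p g"
proof -
  have "hardy_mean p f r = hardy_mean p g r" if "r \<in> {0<..<1}" for r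
    unfolding hardy_mean_eq_circle_mean by (rule circle_mean_cong[OF that]) (simp add: assms)
  then show ?thesis by (simp add: hardy_norm_def)
qed

lemma hardy_mean_add_le:
  assumes p: "1 < p" and AB: "0 < A" "0 < B"
    and f: "f \<in> hardy_space p" "hardy_norm p f \<le> A" and g: "g \<in> hardy_space p" "hardy_norm p g \<le> B"
    and r: "r \<in> {0<..<1}"
  shows "hardy_mean p (\<lambda>z. f z + g z) r \<le> (A + B) powr p"
proof -
  have p0: "0 < p" using p by simp
  note c = f(1)[THEN hardy_space_continuous] g(1)[THEN hardy_space_continuous]
  have bd: "hardy_mean p u r \<le> D powr p" if "u \<in> hardy_space p" "hardy_norm p u \<le> D" for u D
    using hardy_mean_le_norm_powr[OF p0 that(1) r] powr_mono2[OF _ hardy_norm_nonneg that(2), of p] p0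
    by linarith
  define a where "a = (A + B) powr p * (A / (A + B) / A powr p)"
  define b where "b = (A + B) powr p * (B / (A + B) / B powr p)"
  have "hardy_mean p (\<lambda>z. f z + g z) r \<le>
      circle_mean (\<lambda>z. a * cmod (f z) powr p + b * cmod (g z) powr p) r"
    unfolding hardy_mean_eq_circle_mean a_def b_def
    by (intro circle_mean_mono r continuous_on_cmod_powr continuous_intros c p0
        order_trans[OF Minkowski_pointwise[OF p AB]])
       (simp add: algebra_simps)
  also have "\<dots> = a * hardy_mean p f r + b * hardy_mean p g r"
    unfolding hardy_mean_eq_circle_mean circle_mean_cmult[symmetric]
    by (intro circle_mean_add r continuous_on_mult continuous_on_const continuous_on_cmod_powr c p0)
  also have "\<dots> = (A + B) powr p * (A / (A + B) * (hardy_mean p f r / A powr p)) +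
      (A + B) powr p * (B / (A + B) * (hardy_mean p g r / B powr p))"
    by (simp add: a_def b_def)
  also have "\<dots> \<le> (A + B) powr p * (A / (A + B) * 1) + (A + B) powr p * (B / (A + B) * 1)"
    using AB bd[OF f] bd[OF g] by (intro add_mono mult_left_mono) auto
  also have "\<dots> = (A + B) powr p * ((A + B) / (A + B))"
    by (simp only: add_divide_distrib) (simp add: algebra_simps)
  also have "\<dots> = (A + B) powr p" using AB by simp
  finally show ?thesis .
qed

lemma hardy_space_add:
  assumes "1 < p" "f \<in> hardy_space p" "g \<in> hardy_space p"
  shows "(\<lambda>z. f z + g z) \<in> hardy_space p"
proof (rule hardy_spaceI)
  show "(\<lambda>z. f z + g z) holomorphic_on ball 0 1"
    using assms by (auto simp: hardy_space_def intro!: holomorphic_intros)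
  fix r :: real assume "r \<in> {0<..<1}"
  then show "hardy_mean p (\<lambda>z. f z + g z) r \<le> ((hardy_norm p f + 1) + (hardy_norm p g + 1)) powr p"
    using assms hardy_norm_nonneg[of p f] hardy_norm_nonneg[of p g] by (intro hardy_mean_add_le) auto
qed

lemma hardy_norm_triangle:
  assumes "1 < p" "f \<in> hardy_space p" "g \<in> hardy_space p"
  shows "hardy_norm p (\<lambda>z. f z + g z) \<le> hardy_norm p f + hardy_norm p g"
proof (rule field_le_epsilon)
  fix e :: real assume "0 < e"
  then have e: "0 < hardy_norm p f + e / 2" "0 < hardy_norm p g + e / 2"
    using hardy_norm_nonneg[of p f] hardy_norm_nonneg[of p g] by linarith+
  have "hardy_norm p (\<lambda>z. f z + g z) \<le> (hardy_norm p f + e / 2) + (hardy_norm p g + e / 2)"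
    by (rule hardy_norm_le[OF _ _ hardy_mean_add_le[OF assms(1) e]]) (use assms e \<open>0 < e\<close> in auto)
  then show "hardy_norm p (\<lambda>z. f z + g z) \<le> hardy_norm p f + hardy_norm p g + e" by simp
qed

lemma
  assumes p: "0 < p" and u: "u holomorphic_on ball 0 1" "\<And>z. z \<in> ball 0 1 \<Longrightarrow> cmod (u z) \<le> C"
    and f: "f \<in> hardy_space p"
  shows hardy_space_bounded_mult: "(\<lambda>z. u z * f z) \<in> hardy_space p"
    and hardy_norm_bounded_mult: "hardy_norm p (\<lambda>z. u z * f z) \<le> C * hardy_norm p f"
proof -
  have C: "0 \<le> C" using order_trans[OF norm_ge_zero u(2)[of 0]] by simp
  have *: "hardy_mean p (\<lambda>z. u z * f z) r \<le> (C * hardy_norm p f) powr p" if r: "r \<in> {0<..<1}" for r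
  proof -
    have "hardy_mean p (\<lambda>z. u z * f z) r \<le> circle_mean (\<lambda>z. C powr p * cmod (f z) powr p) r"
      unfolding hardy_mean_eq_circle_mean
    proof (intro circle_mean_mono r continuous_on_cmod_powr continuous_intros p hardy_space_continuous[OF f]
        holomorphic_on_imp_continuous_on[OF u(1)])
      fix z :: complex assume z: "z \<in> ball 0 1"
      have "cmod (u z * f z) powr p = cmod (u z) powr p * cmod (f z) powr p"
        by (simp add: norm_mult powr_mult)
      also have "\<dots> \<le> C powr p * cmod (f z) powr p"
        using p u(2)[OF z] by (intro mult_right_mono powr_mono2) auto
      finally show "cmod (u z * f z) powr p \<le> C powr p * cmod (f z) powr p" .
    qed
    also have "\<dots> = C powr p * hardy_mean p f r"
      by (simp add: circle_mean_cmult hardy_mean_eq_circle_mean)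
    also have "\<dots> \<le> C powr p * hardy_norm p f powr p"
      by (intro mult_left_mono hardy_mean_le_norm_powr p f r) auto
    finally show ?thesis using C hardy_norm_nonneg by (simp add: powr_mult)
  qed
  show "(\<lambda>z. u z * f z) \<in> hardy_space p"
    using f u by (intro hardy_spaceI[OF _ *]) (auto simp: hardy_space_def intro!: holomorphic_intros)
  show "hardy_norm p (\<lambda>z. u z * f z) \<le> C * hardy_norm p f"
    using p C hardy_norm_nonneg by (intro hardy_norm_le *) auto
qed

lemma
  assumes p: "0 < p" and u: "u holomorphic_on ball 0 1" "\<And>z. z \<in> ball 0 1 \<Longrightarrow> cmod (u z) \<le> C"
  shows bounded_imp_hardy_space: "u \<in> hardy_space p"
    and hardy_norm_le_bound: "hardy_norm p u \<le> C"
proof -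
  have C: "0 \<le> C" using order_trans[OF norm_ge_zero u(2)[of 0]] by simp
  have *: "hardy_mean p u r \<le> C powr p" if r: "r \<in> {0<..<1}" for r
  proof -
    have "hardy_mean p u r \<le> circle_mean (\<lambda>z. C powr p) r"
      unfolding hardy_mean_eq_circle_mean using p u
      by (intro circle_mean_mono r continuous_on_cmod_powr continuous_intros p
          holomorphic_on_imp_continuous_on[OF u(1)] powr_mono2) auto
    then show ?thesis by (simp add: circle_mean_const)
  qed
  show "u \<in> hardy_space p" by (rule hardy_spaceI[OF u(1) *])
  show "hardy_norm p u \<le> C" by (rule hardy_norm_le[OF p C *])
qed

lemma hardy_space_uminus: "f \<in> hardy_space p \<Longrightarrow> (\<lambda>z. - f z) \<in> hardy_space p"
  by (auto simp: hardy_space_def hardy_mean_def[abs_def] intro!: holomorphic_intros)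

lemma hardy_space_diff:
  assumes "1 < p" "f \<in> hardy_space p" "g \<in> hardy_space p"
  shows "(\<lambda>z. f z - g z) \<in> hardy_space p"
  using hardy_space_add[OF assms(1,2) hardy_space_uminus[OF assms(3)]] by simp

text \<open>
Values below the threshold \<open>d\<close> contribute at most \<open>d\<close> to a first mean, and the others are dominated by
their \<open>p\<close>-th powers. So a small \<open>p\<close>-th mean makes the first mean small.
\<close>

lemma le_threshold_powr:
  fixes x d p :: real
  assumes "0 < d" "0 \<le> x" "1 < p"
  shows "x \<le> d + d powr (1 - p) * x powr p"
proof (cases "x \<le> d")
  case True
  then show ?thesis by (simp add: add_increasing2)
next
  case False
  then have "x = x powr (1 - p) * x powr p" using assms by (simp add: powr_add[symmetric])
  also have "\<dots> \<le> d powr (1 - p) * x powr p"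
    using False assms by (intro mult_right_mono powr_mono2') auto
  finally show ?thesis using assms by linarith
qed

text \<open>
The \<open>p\<close>-th means vanish, so by thresholding the first means are below every positive number, and these
bound the values.
\<close>

lemma hardy_norm_eq_0:
  assumes p: "1 < p" and f: "f \<in> hardy_space p" and 0: "hardy_norm p f = 0" and z: "z \<in> ball 0 1"
  shows "f z = 0"
proof -
  define r where "r = (1 + cmod z) / 2"
  have r: "r \<in> {0<..<1}" "cmod z < r" using z norm_ge_zero[of z] by (auto simp: r_def simp del: norm_ge_zero)
  have cf: "continuous_on (ball 0 1) f" by (rule hardy_space_continuous[OF f])
  have fh: "f holomorphic_on ball 0 1" using f by (simp add: hardy_space_def)
  have p0: "0 < p" using p by simp
  have m0: "hardy_mean p f r \<le> 0" using hardy_mean_le_norm_powr[OF p0 f r(1)] 0 p by simp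
  have "(r - cmod z) * cmod (f z) \<le> 0 + d" if d: "0 < d" for d
  proof -
    have "(r - cmod z) * cmod (f z) \<le> circle_mean (\<lambda>w. cmod (f w)) r"
      by (rule holomorphic_le_circle_mean[OF fh]) (use r in auto)
    also have "\<dots> \<le> circle_mean (\<lambda>w. d + d powr (1 - p) * cmod (f w) powr p) r"
      by (intro circle_mean_mono r continuous_on_cmod_powr continuous_intros cf p0 le_threshold_powr d p) auto
    also have "\<dots> = d + d powr (1 - p) * hardy_mean p f r"
      unfolding hardy_mean_eq_circle_mean circle_mean_cmult[symmetric]
      by (subst circle_mean_add) (intro continuous_on_mult continuous_on_const continuous_on_cmod_powr cf p0 r refl
          | simp add: circle_mean_const)+
    also have "\<dots> \<le> 0 + d" using m0 by (simp add: mult_nonneg_nonpos)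
    finally show ?thesis .
  qed
  then have "(r - cmod z) * cmod (f z) \<le> 0" by (rule field_le_epsilon)
  then show ?thesis using r(2) by (simp add: mult_le_0_iff)
qed

section \<open>Multipliers and invariant subspaces\<close>

text \<open>
The multipliers that occur are continuous functions of an inner function, whose radial limits are part
of its definition. This class records what they inherit from it.
\<close>

definition bounded_with_radial_limits :: "(complex \<Rightarrow> complex) \<Rightarrow> bool" where
  "bounded_with_radial_limits u \<longleftrightarrow> u \<in> hardy_infinity \<and>
     (AE t in lebesgue_on {0..2 * pi}. \<exists>w. has_boundary_value u t w)"

lemma bounded_with_radial_limits_bound:
  assumes "bounded_with_radial_limits u"
  obtains C where "u holomorphic_on ball 0 1" "\<And>z. z \<in> ball 0 1 \<Longrightarrow> cmod (u z) \<le> C"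
proof -
  have "u holomorphic_on ball 0 1" "\<exists>C. \<forall>x\<in>u ` ball 0 1. cmod x \<le> C"
    using assms unfolding bounded_with_radial_limits_def hardy_infinity_def bounded_iff by blast+
  then show thesis using that by blast
qed

lemma has_boundary_value_mult:
  "has_boundary_value u t w \<Longrightarrow> has_boundary_value v t x \<Longrightarrow> has_boundary_value (\<lambda>z. u z * v z) t (w * x)"
  unfolding has_boundary_value_def by (rule tendsto_mult)

lemma bounded_with_radial_limits_mult:
  assumes "bounded_with_radial_limits u" "bounded_with_radial_limits v"
  shows "bounded_with_radial_limits (\<lambda>z. u z * v z)"
proof -
  obtain C where C: "u holomorphic_on ball 0 1" "\<And>z. z \<in> ball 0 1 \<Longrightarrow> cmod (u z) \<le> C"
    using bounded_with_radial_limits_bound[OF assms(1)] by metis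
  obtain D where D: "v holomorphic_on ball 0 1" "\<And>z. z \<in> ball 0 1 \<Longrightarrow> cmod (v z) \<le> D"
    using bounded_with_radial_limits_bound[OF assms(2)] by metis
  have "cmod (u z * v z) \<le> C * D" if "z \<in> ball 0 1" for z
    unfolding norm_mult using C(2)[OF that] D(2)[OF that] order_trans[OF norm_ge_zero C(2)[OF that]]
    by (intro mult_mono) auto
  then have "bounded ((\<lambda>z. u z * v z) ` ball 0 1)" by (intro boundedI[where B = "C * D"]) blast
  then have "(\<lambda>z. u z * v z) \<in> hardy_infinity"
    using C D by (auto simp: hardy_infinity_def intro!: holomorphic_intros)
  moreover have "AE t in lebesgue_on {0..2 * pi}. \<exists>w. has_boundary_value (\<lambda>z. u z * v z) t w"
    using assms[unfolded bounded_with_radial_limits_def, THEN conjunct2]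
    by eventually_elim (blast intro: has_boundary_value_mult)
  ultimately show ?thesis by (simp add: bounded_with_radial_limits_def)
qed

lemma bounded_with_radial_limits_poly: "bounded_with_radial_limits (poly P)"
proof -
  have "bounded (poly P ` cball 0 1)"
    by (intro compact_imp_bounded compact_continuous_image continuous_intros) auto
  then have "bounded (poly P ` ball 0 1)" by (rule bounded_subset) auto
  moreover have "has_boundary_value (poly P) t (poly P (of_real 1 * cis t))" for t
    unfolding has_boundary_value_def by (intro tendsto_intros)
  ultimately show ?thesis
    by (auto simp: bounded_with_radial_limits_def hardy_infinity_def intro!: holomorphic_intros)
qed

text \<open>
A bound uniform in \<open>r\<close> follows by compactness. Otherwise there are dilation factors tending to \<open>1\<close> and
radii \<open>s n\<close> at which the mean exceeds \<open>e\<close>; along a subsequence \<open>s n\<close> converges to some \<open>l\<close>. The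
integrands tend to zero almost everywhere, by continuity if \<open>l < 1\<close> and because both points
approach the same boundary point radially if \<open>l = 1\<close>. By dominated convergence the means tend to zero, a contradiction.
\<close>

lemma dilation_mean_approx:
  assumes u: "bounded_with_radial_limits u" and p: "0 < p" and e: "0 < e"
  obtains \<rho> where "\<rho> \<in> {0<..<1}" "\<And>r. r \<in> {0<..<1} \<Longrightarrow> hardy_mean p (\<lambda>z. u z - u (of_real \<rho> * z)) r \<le> e"
proof (rule ccontr)
  assume "\<not> thesis"
  then have "\<exists>r. r \<in> {0<..<1} \<and> \<not> hardy_mean p (\<lambda>z. u z - u (of_real (radius n) * z)) r \<le> e" for n
    using that radius_in by blast
  then obtain s where s: "\<And>n. s n \<in> {0<..<1}"
    and big: "\<And>n. e < hardy_mean p (\<lambda>z. u z - u (of_real (radius n) * z)) (s n)"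
    by (metis not_le)
  have "seq_compact {0..1::real}" by (simp add: compact_imp_seq_compact)
  moreover have "\<forall>n. s n \<in> {0..1}" using s by (simp add: less_imp_le)
  ultimately obtain l \<sigma> where l: "l \<in> {0..1}" and \<sigma>: "strict_mono \<sigma>" and lim: "(s \<circ> \<sigma>) \<longlonglongrightarrow> l"
    by (rule seq_compactE)
  define x where "x n = s (\<sigma> n)" for n
  define y where "y n = radius (\<sigma> n) * x n" for n
  have x: "x n \<in> {0<..<1}" for n using s by (simp add: x_def)
  have y: "y n \<in> {0<..<1}" for n
    using x[of n] radius_in[of "\<sigma> n"] mult_strict_mono[of "radius (\<sigma> n)" 1 "x n" 1] by (auto simp: y_def)
  have xl: "x \<longlonglongrightarrow> l" using lim by (simp add: x_def[abs_def] o_def)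
  have yl: "y \<longlonglongrightarrow> l"
    using tendsto_mult[OF LIMSEQ_subseq_LIMSEQ[OF radius_tendsto \<sigma>] xl] by (simp add: y_def[abs_def] o_def)
  obtain C where C: "u holomorphic_on ball 0 1" "\<And>z. z \<in> ball 0 1 \<Longrightarrow> cmod (u z) \<le> C"
    using bounded_with_radial_limits_bound[OF u] by metis
  have cu: "continuous_on (ball 0 1) u" using C(1) holomorphic_on_imp_continuous_on by blast
  have "AE t in lebesgue_on {0..2 * pi}. \<exists>w. has_boundary_value u t w"
    using u by (simp add: bounded_with_radial_limits_def)
  then have "AE t in lebesgue_on {0..2 * pi}.
      (\<lambda>n. cmod (u (of_real (x n) * cis t) - u (of_real (y n) * cis t)) powr p) \<longlonglongrightarrow> 0"
  proof eventually_elim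
    case (elim t)
    have "\<exists>w. (\<lambda>n. u (of_real (x n) * cis t)) \<longlonglongrightarrow> w \<and> (\<lambda>n. u (of_real (y n) * cis t)) \<longlonglongrightarrow> w"
    proof (cases "l = 1")
      case True
      obtain w where w: "has_boundary_value u t w" using elim by blast
      show ?thesis
        using has_boundary_value_sequence[OF w] xl yl x y True by (intro exI[of _ w]) auto
    next
      case False
      then have "of_real l * cis t \<in> ball (0::complex) 1" using l by (simp add: norm_mult)
      then have "isCont u (of_real l * cis t)"
        using cu by (simp add: continuous_on_eq_continuous_at)
      then show ?thesis
        by (intro exI[of _ "u (of_real l * cis t)"] conjI)
           (auto intro!: isCont_tendsto_compose[where g = u] tendsto_intros xl yl)
    qed
    then obtain w where "(\<lambda>n. u (of_real (x n) * cis t)) \<longlonglongrightarrow> w" "(\<lambda>n. u (of_real (y n) * cis t)) \<longlonglongrightarrow> w"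
      by blast
    from tendsto_norm[OF tendsto_diff[OF this]]
    have "(\<lambda>n. cmod (u (of_real (x n) * cis t) - u (of_real (y n) * cis t))) \<longlonglongrightarrow> 0" by simp
    from tendsto_powr'[OF this tendsto_const[of p]] p show ?case by simp
  qed
  then have "(\<lambda>n. integral {0..2*pi} (\<lambda>t. cmod (u (of_real (x n) * cis t) - u (of_real (y n) * cis t)) powr p))
      \<longlonglongrightarrow> integral {0..2*pi} (\<lambda>t. 0)"
  proof (rule dominated_convergence_AE_interval(2)[where C = "(C + C) powr p", rotated 3])
    fix n and t :: real
    show "continuous_on {0..2 * pi} (\<lambda>t. cmod (u (of_real (x n) * cis t) - u (of_real (y n) * cis t)) powr p)"
      by (intro continuous_on_cmod_powr continuous_intros continuous_on_circle x y cu p)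
    show "norm (cmod (u (of_real (x n) * cis t) - u (of_real (y n) * cis t)) powr p) \<le> (C + C) powr p"
      using p order_trans[OF norm_triangle_ineq4
          add_mono[OF C(2)[OF circle_in_ball[OF x]] C(2)[OF circle_in_ball[OF y]]]]
      by (simp add: powr_mono2)
  qed auto
  from tendsto_mult[OF tendsto_const[of "1 / (2 * pi)"] this]
  have "(\<lambda>n. hardy_mean p (\<lambda>z. u z - u (of_real (radius (\<sigma> n)) * z)) (s (\<sigma> n))) \<longlonglongrightarrow> 0"
    by (simp add: hardy_mean_def x_def y_def mult.assoc)
  from LIMSEQ_le_const[OF this, of e] big have "e \<le> 0" by (auto intro: less_imp_le)
  then show False using e by simp
qed

lemma dilation_in_ball:
  assumes "\<rho> \<in> {0<..<1}" "z \<in> ball 0 1"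
  shows "of_real \<rho> * z \<in> ball (0::complex) 1" "of_real \<rho> * z \<in> cball 0 \<rho>"
  using assms mult_strict_mono[of \<rho> 1 "cmod z" 1] by (auto simp: norm_mult mult_left_le)

text \<open>
The Taylor series converges uniformly on the closed disk of radius \<open>\<rho>\<close>; rescaling its partial sums
by \<open>\<rho>\<close> gives the polynomial.
\<close>

lemma dilation_uniform_approx:
  assumes u: "u holomorphic_on ball 0 1" and \<rho>: "\<rho> \<in> {0<..<1}" and e: "0 < e"
  obtains P where "\<And>z. z \<in> ball 0 1 \<Longrightarrow> cmod (u (of_real \<rho> * z) - poly P z) \<le> e"
proof -
  define a where "a n = (deriv ^^ n) u 0 / fact n" for n
  have sums: "(\<lambda>n. a n * z ^ n) sums u z" if "z \<in> ball 0 1" for z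
    using holomorphic_power_series[OF u that] by (simp add: a_def)
  obtain \<rho>' where \<rho>': "\<rho> < \<rho>'" "\<rho>' < 1" using \<rho> dense by auto
  have "ereal (norm (of_real \<rho>' :: complex)) \<le> conv_radius a"
    by (rule conv_radius_geI, rule sums_summable, rule sums) (use \<rho> \<rho>' in auto)
  then have "ereal \<rho> < conv_radius a" using \<rho> \<rho>' by (auto intro: less_le_trans[of _ "ereal \<rho>'"])
  from powser_uniform_limit[OF this, of 0]
  have "uniform_limit (cball 0 \<rho>) (\<lambda>n z. \<Sum>i<n. a i * z ^ i) (\<lambda>z. \<Sum>i. a i * z ^ i) sequentially"
    by simp
  from uniform_limitD[OF this e] obtain n where
    n: "\<And>z. z \<in> cball 0 \<rho> \<Longrightarrow> dist (\<Sum>i<n. a i * z ^ i) (\<Sum>i. a i * z ^ i) < e"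
    unfolding eventually_sequentially by blast
  define P where "P = (\<Sum>i<n. monom (a i * of_real \<rho> ^ i) i)"
  show thesis
  proof (rule that[of P])
    fix z :: complex assume z: "z \<in> ball 0 1"
    have z1: "of_real \<rho> * z \<in> cball 0 \<rho>" and z2: "of_real \<rho> * z \<in> ball 0 1"
      using dilation_in_ball[OF \<rho> z] by auto
    have "poly P z = (\<Sum>i<n. a i * (of_real \<rho> * z) ^ i)"
      by (simp add: P_def poly_sum poly_monom power_mult_distrib mult.assoc)
    then show "cmod (u (of_real \<rho> * z) - poly P z) \<le> e"
      using n[OF z1] sums_unique[OF sums[OF z2]] by (simp add: dist_norm norm_minus_commute)
  qed
qed

lemma polynomial_approx_hardy:
  assumes u: "bounded_with_radial_limits u" and p: "1 < p" and e: "0 < e"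
  obtains P where "hardy_norm p (\<lambda>z. u z - poly P z) < e"
proof -
  have p0: "0 < p" using p by simp
  obtain \<rho> where \<rho>: "\<rho> \<in> {0<..<1}"
    and m: "\<And>r. r \<in> {0<..<1} \<Longrightarrow> hardy_mean p (\<lambda>z. u z - u (of_real \<rho> * z)) r \<le> (e / 3) powr p"
    using dilation_mean_approx[OF u p0, of "(e/3) powr p"] e by auto
  have u': "u holomorphic_on ball 0 1" using bounded_with_radial_limits_bound[OF u] by metis
  obtain P where P: "\<And>z. z \<in> ball 0 1 \<Longrightarrow> cmod (u (of_real \<rho> * z) - poly P z) \<le> e / 3"
    using dilation_uniform_approx[OF u' \<rho>, of "e / 3"] e by auto
  have "of_real \<rho> * z \<in> ball 0 1" if "z \<in> ball 0 1" for z :: complex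
    using dilation_in_ball[OF \<rho> that] by simp
  then have ur: "(\<lambda>z. u (of_real \<rho> * z)) holomorphic_on ball 0 1"
    by (intro holomorphic_on_compose_gen[OF _ u', unfolded o_def] holomorphic_intros) auto
  have A: "(\<lambda>z. u z - u (of_real \<rho> * z)) \<in> hardy_space p"
    by (rule hardy_spaceI[OF _ m]) (auto intro!: holomorphic_intros u' ur)
  have An: "hardy_norm p (\<lambda>z. u z - u (of_real \<rho> * z)) \<le> e / 3"
    using e p0 by (intro hardy_norm_le m) auto
  have Bh: "(\<lambda>z. u (of_real \<rho> * z) - poly P z) holomorphic_on ball 0 1"
    by (intro holomorphic_intros ur)
  have B: "(\<lambda>z. u (of_real \<rho> * z) - poly P z) \<in> hardy_space p"
    by (rule bounded_imp_hardy_space[OF p0 Bh P])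
  have Bn: "hardy_norm p (\<lambda>z. u (of_real \<rho> * z) - poly P z) \<le> e / 3"
    by (rule hardy_norm_le_bound[OF p0 Bh P])
  have "hardy_norm p (\<lambda>z. u z - poly P z) \<le> e / 3 + e / 3"
    using hardy_norm_triangle[OF p A B] An Bn by simp
  then show thesis using e by (intro that[of P]) simp
qed

lemma span_shifts_eq:
  "complex_fun.span (range (\<lambda>k::nat. \<lambda>z. z ^ k * f z)) = range (\<lambda>P z. poly P z * f z)"
proof (rule complex_fun.span_unique)
  show "range (\<lambda>(k::nat) z. z ^ k * f z) \<subseteq> range (\<lambda>P z. poly P z * f z)"
  proof clarify
    fix k :: nat
    show "(\<lambda>z. z ^ k * f z) \<in> range (\<lambda>P z. poly P z * f z)"
      by (rule image_eqI[of _ _ "monom 1 k"]) (auto simp: poly_monom)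
  qed
  show "complex_fun.subspace (range (\<lambda>P z. poly P z * f z))"
  proof (rule complex_fun.subspaceI)
    show "0 \<in> range (\<lambda>P z. poly P z * f z)"
      by (rule image_eqI[of _ _ 0]) (auto simp: fun_eq_iff)
  next
    fix x y assume "x \<in> range (\<lambda>P z. poly P z * f z)" "y \<in> range (\<lambda>P z. poly P z * f z)"
    then obtain P Q where "x = (\<lambda>z. poly P z * f z)" "y = (\<lambda>z. poly Q z * f z)" by auto
    then show "x + y \<in> range (\<lambda>P z. poly P z * f z)"
      by (intro image_eqI[of _ _ "P + Q"]) (auto simp: fun_eq_iff algebra_simps)
  next
    fix c x assume "x \<in> range (\<lambda>P z. poly P z * f z)"
    then obtain P where "x = (\<lambda>z. poly P z * f z)" by auto
    then show "(\<lambda>z. c * x z) \<in> range (\<lambda>P z. poly P z * f z)"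
      by (intro image_eqI[of _ _ "smult c P"]) (auto simp: fun_eq_iff algebra_simps)
  qed
next
  fix T assume T: "range (\<lambda>(k::nat) z. z ^ k * f z) \<subseteq> T" "complex_fun.subspace T"
  have "(\<lambda>z. (\<Sum>i<n. c i * z ^ i) * f z) \<in> T" for c :: "nat \<Rightarrow> complex" and n
  proof (induction n)
    case 0
    show ?case using complex_fun.subspace_0[OF T(2)] by (simp add: zero_fun_def)
  next
    case (Suc n)
    have "(\<lambda>z. c n * (z ^ n * f z)) \<in> T"
      using T(1) by (intro complex_fun.subspace_scale[OF T(2)]) auto
    from complex_fun.subspace_add[OF T(2) Suc this]
    show ?case by (simp add: plus_fun_def algebra_simps)
  qed
  from this[of "coeff P" "Suc (degree P)" for P]
  show "range (\<lambda>P z. poly P z * f z) \<subseteq> T"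
    by (auto simp: poly_altdef lessThan_Suc_atMost)
qed

lemma mem_shift_invariant_hull_iff:
  "g \<in> shift_invariant_hull p f \<longleftrightarrow> g \<in> hardy_space p \<and>
     (\<forall>e>0. \<exists>P. hardy_norm p (\<lambda>z. g z - poly P z * f z) < e)"
  by (simp add: shift_invariant_hull_def hardy_closure_def span_shifts_eq)

lemma hardy_infinity_bound:
  assumes "f \<in> hardy_infinity"
  obtains C where "0 < C" "f holomorphic_on ball 0 1" "\<And>z. z \<in> ball 0 1 \<Longrightarrow> cmod (f z) \<le> C"
  using assms unfolding hardy_infinity_def bounded_pos by auto

text \<open>
Multiplication by the bounded function \<open>f\<close> preserves the approximation of \<open>u\<close> by polynomials.
\<close>

lemma multiplier_mem_hull:
  assumes p: "1 < p" and u: "bounded_with_radial_limits u" and f: "f \<in> hardy_infinity"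
  shows "(\<lambda>z. u z * f z) \<in> shift_invariant_hull p f"
  unfolding mem_shift_invariant_hull_iff
proof (intro conjI allI impI)
  have p0: "0 < p" using p by simp
  obtain D where D: "0 < D" "f holomorphic_on ball 0 1" "\<And>z. z \<in> ball 0 1 \<Longrightarrow> cmod (f z) \<le> D"
    using hardy_infinity_bound[OF f] by metis
  obtain C where C: "u holomorphic_on ball 0 1" "\<And>z. z \<in> ball 0 1 \<Longrightarrow> cmod (u z) \<le> C"
    using bounded_with_radial_limits_bound[OF u] by metis
  have hs: "u \<in> hardy_space p" "f \<in> hardy_space p"
    using bounded_imp_hardy_space p0 C D by blast+
  show "(\<lambda>z. u z * f z) \<in> hardy_space p"
    by (rule hardy_space_bounded_mult[OF p0 C hs(2)])
  fix e :: real assume e: "0 < e"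
  obtain P where P: "hardy_norm p (\<lambda>z. u z - poly P z) < e / D"
    using polynomial_approx_hardy[OF u p, of "e / D"] e D by auto
  have "poly P \<in> hardy_space p"
    using bounded_with_radial_limits_bound[OF bounded_with_radial_limits_poly[of P]] 
      bounded_imp_hardy_space[OF p0] by metis
  then have "(\<lambda>z. u z - poly P z) \<in> hardy_space p" using hardy_space_diff[OF p hs(1)] by blast
  from hardy_norm_bounded_mult[OF p0 D(2,3) this]
  have "hardy_norm p (\<lambda>z. f z * (u z - poly P z)) \<le> D * hardy_norm p (\<lambda>z. u z - poly P z)" .
  also have "\<dots> < e" using P D by (simp add: field_simps)
  finally have "hardy_norm p (\<lambda>z. f z * (u z - poly P z)) < e" .
  then show "\<exists>P. hardy_norm p (\<lambda>z. u z * f z - poly P z * f z) < e"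
    by (intro exI[of _ P]) (simp add: algebra_simps)
qed

text \<open>
A polynomial multiple of \<open>g\<close> is \<open>f\<close> times a multiplier of the same class as \<open>u\<close>, hence again a limit
of polynomial multiples of \<open>f\<close>. Only the values on the disk enter.
\<close>

lemma hull_mono_multiplier:
  assumes p: "1 < p" and u: "bounded_with_radial_limits u" and f: "f \<in> hardy_infinity"
    and g: "\<And>z. z \<in> ball 0 1 \<Longrightarrow> g z = u z * f z"
  shows "shift_invariant_hull p g \<subseteq> shift_invariant_hull p f"
proof
  fix k assume k: "k \<in> shift_invariant_hull p g"
  show "k \<in> shift_invariant_hull p f"
    unfolding mem_shift_invariant_hull_iff
  proof (intro conjI allI impI)
    show kp: "k \<in> hardy_space p" using k by (simp add: mem_shift_invariant_hull_iff)
    fix e :: real assume "0 < e"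
    then have e: "0 < e / 2" by simp
    obtain Q where Q: "hardy_norm p (\<lambda>z. k z - poly Q z * g z) < e / 2"
      using k e unfolding mem_shift_invariant_hull_iff by blast
    define v where "v = (\<lambda>z. (poly Q z * u z) * f z)"
    have v: "v \<in> shift_invariant_hull p f"
      unfolding v_def
      by (intro multiplier_mem_hull p f bounded_with_radial_limits_mult bounded_with_radial_limits_poly u)
    then obtain P where P: "hardy_norm p (\<lambda>z. v z - poly P z * f z) < e / 2"
      using e unfolding mem_shift_invariant_hull_iff by blast
    have Pf: "(\<lambda>z. poly P z * f z) \<in> hardy_space p"
      using multiplier_mem_hull[OF p bounded_with_radial_limits_poly f]
      unfolding mem_shift_invariant_hull_iff by blast
    have vp: "v \<in> hardy_space p" using v unfolding mem_shift_invariant_hull_iff by blast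
    have "hardy_norm p (\<lambda>z. k z - v z) = hardy_norm p (\<lambda>z. k z - poly Q z * g z)"
      by (rule hardy_cong) (simp add: v_def g)
    with hardy_norm_triangle[OF p hardy_space_diff[OF p kp vp] hardy_space_diff[OF p vp Pf]] P Q
    show "\<exists>P. hardy_norm p (\<lambda>z. k z - poly P z * f z) < e"
      by (intro exI[of _ P]) simp
  qed
qed

section \<open>Herglotz's formula and outer functions\<close>

lemma cauchy_kernel_conj:
  assumes "cmod z < 1"
  shows "cnj (cis t / (cis t - z)) = 1 / (1 - cnj z * cis t)"
proof -
  have 1: "cis t - z \<noteq> 0"
    using assms norm_cis[of t] by (metis eq_iff_diff_eq_0 less_irrefl)
  have 2: "1 - cnj z * cis t \<noteq> 0"
  proof
    assume "1 - cnj z * cis t = 0"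
    then have "cmod (cnj z * cis t) = 1" by (metis eq_iff_diff_eq_0 norm_one)
    then show False using assms by (simp add: norm_mult)
  qed
  have 3: "cis t * cnj (cis t) = 1" by (simp add: cis_cnj cis_mult)
  have 4: "cnj (cis t) - cnj z \<noteq> 0" using 1 by (metis complex_cnj_diff complex_cnj_zero_iff)
  have "cnj (cis t) * (1 - cnj z * cis t) = cnj (cis t) - cnj z * (cis t * cnj (cis t))"
    by (simp add: algebra_simps)
  then have "cnj (cis t) * (1 - cnj z * cis t) = 1 * (cnj (cis t) - cnj z)" by (simp only: 3) simp
  then show ?thesis
    unfolding complex_cnj_divide complex_cnj_diff by (simp only: frac_eq_eq[OF 4 2])
qed

text \<open>
The conjugate of the integrand is \<open>f (r e) / (1 - cnj z * e)\<close> with \<open>e = cis t\<close>, a holomorphic function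
of \<open>e\<close> on a disk slightly larger than the unit disk, so the mean value property evaluates it.
\<close>

lemma conj_Cauchy_has_integral:
  assumes f: "f holomorphic_on ball 0 1" and r: "r \<in> {0<..<1}" and z: "z \<in> ball 0 1"
  shows "((\<lambda>t. cnj (f (of_real r * cis t)) * (cis t / (cis t - z)))
    has_integral 2 * of_real pi * cnj (f 0)) {0..2 * pi}"
proof -
  obtain s where s: "max r (cmod z) < s" "s < 1"
    using dense[of "max r (cmod z)" 1] r z by auto
  have s0: "0 < s" using r s by auto
  define g where "g w = f (of_real (r / s) * w) / (1 - cnj z * w / of_real s)" for w
  have "g holomorphic_on ball 0 1"
    unfolding g_def
  proof (intro holomorphic_intros holomorphic_on_compose_gen[OF _ f, unfolded o_def])
    have "r / s \<in> {0<..<1}" using r s s0 by auto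
    from dilation_in_ball(1)[OF this] show "(*) (of_real (r / s)) ` ball 0 1 \<subseteq> ball (0::complex) 1"
      by auto
    fix w :: complex assume w: "w \<in> ball 0 1"
    show "1 - cnj z * w / of_real s \<noteq> 0"
    proof
      assume "1 - cnj z * w / of_real s = 0"
      then have "cnj z * w = of_real s" using s0 by (auto simp: field_simps)
      then have "cmod z * cmod w = s" using s0 by (metis complex_mod_cnj norm_mult norm_of_real abs_of_pos)
      moreover have "cmod z * cmod w \<le> cmod z" using w by (intro mult_left_le) auto
      ultimately show False using s by auto
    qed
  qed (use s0 in auto)
  from mean_value_has_integral[OF this, of s] s s0
  have "((\<lambda>t. g (of_real s * cis t)) has_integral 2 * of_real pi * f 0) {0..2 * pi}"
    by (simp add: g_def)
  then have "(cnj \<circ> (\<lambda>t. g (of_real s * cis t)) has_integral cnj (2 * of_real pi * f 0)) {0..2 * pi}"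
    by (simp only: has_integral_cnj)
  moreover have "cnj \<circ> (\<lambda>t. g (of_real s * cis t)) =
      (\<lambda>t. cnj (f (of_real r * cis t)) * (cis t / (cis t - z)))"
  proof
    fix t
    have "g (of_real s * cis t) = f (of_real r * cis t) * (1 / (1 - cnj z * cis t))"
      using s0 by (simp add: g_def)
    also have "\<dots> = f (of_real r * cis t) * cnj (cis t / (cis t - z))"
      using z by (simp only: cauchy_kernel_conj mem_ball dist_0_norm)
    finally show "(cnj \<circ> (\<lambda>t. g (of_real s * cis t))) t =
        cnj (f (of_real r * cis t)) * (cis t / (cis t - z))" by simp
  qed
  moreover have "cnj (2 * of_real pi * f 0) = 2 * of_real pi * cnj (f 0)" by simp
  ultimately show ?thesis by (simp only:)
qed

text \<open>
With \<open>K = cis t / (cis t - z)\<close> the Herglotz kernel is \<open>2 K - 1\<close> and \<open>Re f = (f + cnj f) / 2\<close>.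
Expanding the product leaves Cauchy's formula, its conjugate version, and two mean values.
\<close>

lemma Herglotz_circle:
  assumes f: "f holomorphic_on ball 0 1" and r: "r \<in> {0<..<1}" and z: "z \<in> ball 0 1"
  shows "((\<lambda>t. (cis t + z) / (cis t - z) * of_real (Re (f (of_real r * cis t))))
    has_integral 2 * of_real pi * (f (of_real r * z) - \<i> * of_real (Im (f 0)))) {0..2 * pi}"
proof -
  let ?f = "\<lambda>t. f (of_real r * cis t)" and ?K = "\<lambda>t. cis t / (cis t - z)"
  have rz: "cmod (of_real r * z) < r" using r z by (simp add: norm_mult)
  have K: "of_real r * cis t / (of_real r * cis t - of_real r * z) = ?K t" for t
    using r by (simp flip: right_diff_distrib)
  have "((\<lambda>t. ?f t * ?K t) has_integral 2 * of_real pi * f (of_real r * z)) {0..2 * pi}"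
    using Cauchy_has_integral_circle[OF f _ _ rz] r unfolding K by simp
  from has_integral_diff[OF has_integral_add[OF this conj_Cauchy_has_integral[OF f r z]]
      has_integral_mult_right[OF has_integral_add[OF mean_value_has_integral[OF f r]
          has_integral_cnj[THEN iffD2, OF mean_value_has_integral[OF f r]]], of "1/2"]]
  have "((\<lambda>t. ?f t * ?K t + cnj (?f t) * ?K t - 1 / 2 * (?f t + (cnj \<circ> ?f) t)) has_integral
     2 * of_real pi * f (of_real r * z) + 2 * of_real pi * cnj (f 0) -
     1 / 2 * (2 * of_real pi * f 0 + cnj (2 * of_real pi * f 0))) {0..2 * pi}" .
  moreover have "?f t * ?K t + cnj (?f t) * ?K t - 1 / 2 * (?f t + (cnj \<circ> ?f) t) =
      (cis t + z) / (cis t - z) * of_real (Re (?f t))" for t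
  proof -
    have "cis t - z \<noteq> 0"
      using z norm_cis[of t] by (metis eq_iff_diff_eq_0 less_irrefl mem_ball dist_0_norm)
    then have A: "(cis t + z) / (cis t - z) = 2 * ?K t - 1" by (simp add: field_simps)
    have B: "complex_of_real (Re (?f t)) = (?f t + cnj (?f t)) / 2"
      by (simp add: complex_add_cnj)
    have "a * K + b * K - 1 / 2 * (a + b) = (2 * K - 1) * ((a + b) / 2)" for a b K :: complex
      by (simp add: field_simps)
    then show ?thesis unfolding A B o_def .
  qed
  moreover have "2 * of_real pi * f (of_real r * z) + 2 * of_real pi * cnj (f 0) -
      1 / 2 * (2 * of_real pi * f 0 + cnj (2 * of_real pi * f 0)) =
      2 * of_real pi * (f (of_real r * z) - \<i> * of_real (Im (f 0)))"
    using complex_diff_cnj[of "f 0"] by (simp add: algebra_simps complex_eq_iff)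
  ultimately show ?thesis by simp
qed

text \<open>
Herglotz's formula on the circles \<open>radius n\<close>; the kernel is bounded for fixed \<open>z\<close>, so dominated
convergence carries it to the boundary.
\<close>

lemma Herglotz_boundary:
  assumes u: "bounded_with_radial_limits u"
    and v: "v \<in> borel_measurable lebesgue"
    and lim: "AE t in lebesgue_on {0..2 * pi}. (\<lambda>n. Re (u (of_real (radius n) * cis t))) \<longlonglongrightarrow> v t"
  shows "v absolutely_integrable_on {0..2 * pi}"
    and "\<And>z. z \<in> ball 0 1 \<Longrightarrow> u z = \<i> * of_real (Im (u 0)) +
      1 / (2 * pi) * integral {0..2 * pi} (\<lambda>t. (cis t + z) / (cis t - z) * of_real (v t))"
proof -
  obtain C where C: "u holomorphic_on ball 0 1" "\<And>z. z \<in> ball 0 1 \<Longrightarrow> cmod (u z) \<le> C"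
    using bounded_with_radial_limits_bound[OF u] by metis
  have cu: "continuous_on (ball 0 1) u" using C(1) holomorphic_on_imp_continuous_on by blast
  have C0: "0 \<le> C" using order_trans[OF norm_ge_zero C(2)[of 0]] by simp
  have vm: "v \<in> borel_measurable (lebesgue_on {0..2 * pi})"
    using v by (rule measurable_restrict_space1)
  have cR: "continuous_on {0..2 * pi} (\<lambda>t. Re (u (of_real (radius n) * cis t)))" for n
    by (intro continuous_intros continuous_on_circle[OF cu] radius_in)
  have bR: "\<bar>Re (u (of_real (radius n) * cis t))\<bar> \<le> C" for n t
    using abs_Re_le_cmod C(2)[OF circle_in_ball[OF radius_in]] order_trans by blast
  have "integrable (lebesgue_on {0..2 * pi}) v"
    by (rule dominated_convergence_AE_interval(1)[OF cR _ vm lim]) (use bR in auto)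
  then show "v absolutely_integrable_on {0..2 * pi}"
    using vm by (simp add: absolutely_integrable_measurable integrable_norm o_def)
  fix z :: complex assume z: "z \<in> ball 0 1"
  define H where "H t = (cis t + z) / (cis t - z)" for t
  have ne: "cis t - z \<noteq> 0" for t
    using z norm_cis[of t] by (metis eq_iff_diff_eq_0 less_irrefl mem_ball dist_0_norm)
  have cH: "continuous_on S H" for S
    unfolding H_def by (intro continuous_intros) (use ne in auto)
  obtain B where B: "\<And>t. t \<in> {0..2 * pi} \<Longrightarrow> cmod (H t) \<le> B"
    using compact_imp_bounded[OF compact_continuous_image[OF cH compact_Icc[of 0 "2 * pi"]]]
    unfolding bounded_iff by blast
  have "(\<lambda>n. integral {0..2 * pi} (\<lambda>t. H t * of_real (Re (u (of_real (radius n) * cis t)))))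
      \<longlonglongrightarrow> integral {0..2 * pi} (\<lambda>t. H t * of_real (v t))"
  proof (rule dominated_convergence_AE_interval(2)[where C = "B * C"])
    show "continuous_on {0..2 * pi} (\<lambda>t. H t * of_real (Re (u (of_real (radius n) * cis t))))" for n
      by (intro continuous_intros cH cR)
    show "cmod (H t * of_real (Re (u (of_real (radius n) * cis t)))) \<le> B * C"
      if "t \<in> {0..2 * pi}" for n t
      using mult_mono[OF B[OF that] bR] C0 order_trans[OF norm_ge_zero B[OF that]]
      by (simp add: norm_mult)
    have "H \<in> borel_measurable (lebesgue_on {0..2 * pi})"
      by (rule continuous_imp_measurable_on_sets_lebesgue[OF cH]) auto
    then show "(\<lambda>t. H t * of_real (v t)) \<in> borel_measurable (lebesgue_on {0..2 * pi})"
      using vm by measurable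
    show "AE t in lebesgue_on {0..2 * pi}.
        (\<lambda>n. H t * of_real (Re (u (of_real (radius n) * cis t)))) \<longlonglongrightarrow> H t * of_real (v t)"
      using lim by eventually_elim (intro tendsto_intros)
  qed
  then have lim1: "(\<lambda>n. 2 * of_real pi * (u (of_real (radius n) * z) - \<i> * of_real (Im (u 0))))
      \<longlonglongrightarrow> integral {0..2 * pi} (\<lambda>t. H t * of_real (v t))"
    using integral_unique[OF Herglotz_circle[OF C(1) radius_in z]] by (simp add: H_def)
  have "isCont u (of_real 1 * z)" using cu z by (simp add: continuous_on_eq_continuous_at)
  moreover have "(\<lambda>n. of_real (radius n) * z) \<longlonglongrightarrow> of_real 1 * z"
    by (intro tendsto_intros radius_tendsto)
  ultimately have "(\<lambda>n. u (of_real (radius n) * z)) \<longlonglongrightarrow> u (of_real 1 * z)"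
    by (rule isCont_tendsto_compose)
  then have "(\<lambda>n. 2 * of_real pi * (u (of_real (radius n) * z) - \<i> * of_real (Im (u 0))))
      \<longlonglongrightarrow> 2 * of_real pi * (u (of_real 1 * z) - \<i> * of_real (Im (u 0)))"
    by (intro tendsto_intros)
  from LIMSEQ_unique[OF lim1 this]
  show "u z = \<i> * of_real (Im (u 0)) +
      1 / (2 * pi) * integral {0..2 * pi} (\<lambda>t. (cis t + z) / (cis t - z) * of_real (v t))"
    by (simp add: H_def field_simps)
qed

text \<open>
The weight in the definition of an outer function is \<open>exp\<close> of the radial limit of \<open>Re u\<close>, and the
unimodular constant is \<open>exp (\<i> * Im (u 0))\<close>. The exponential makes the weight positive even at points where
the radial limit does not exist and \<open>lim\<close> has an arbitrary value.
\<close>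

lemma outer_function_exp:
  assumes u: "bounded_with_radial_limits u" and h: "\<And>z. z \<in> ball 0 1 \<Longrightarrow> h z = exp (u z)"
  shows "outer_function h"
proof -
  have cu: "continuous_on (ball 0 1) u"
    using bounded_with_radial_limits_bound[OF u] holomorphic_on_imp_continuous_on by metis
  define v where "v t = lim (\<lambda>n. Re (u (of_real (radius n) * cis t)))" for t
  have "(\<lambda>t. Re (u (of_real (radius n) * cis t))) \<in> borel_measurable borel" for n
    by (intro borel_measurable_continuous_onI continuous_intros continuous_on_circle[OF cu] radius_in)
  then have "v \<in> borel_measurable lborel"
    unfolding v_def by (auto intro!: borel_measurable_lim_metric)
  then have v: "v \<in> borel_measurable lebesgue" by (rule measurable_completion)
  have "AE t in lebesgue_on {0..2 * pi}. \<exists>w. has_boundary_value u t w"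
    using u by (simp add: bounded_with_radial_limits_def)
  then have lim: "AE t in lebesgue_on {0..2 * pi}.
      (\<lambda>n. Re (u (of_real (radius n) * cis t))) \<longlonglongrightarrow> v t"
  proof eventually_elim
    case (elim t)
    then obtain w where "has_boundary_value u t w" by blast
    from tendsto_Re[OF has_boundary_value_sequence[OF this radius_tendsto]] radius_in
    have "(\<lambda>n. Re (u (of_real (radius n) * cis t))) \<longlonglongrightarrow> Re w" by auto
    then show ?case by (simp add: v_def limI)
  qed
  note H = Herglotz_boundary[OF u v lim]
  have m: "(\<lambda>t. exp (v t)) \<in> borel_measurable lebesgue" using v by measurable
  have "h z = exp (\<i> * of_real (Im (u 0))) * exp (1 / (2 * pi) *
             integral {0..2 * pi} (\<lambda>t. (cis t + z) / (cis t - z) * of_real (ln (exp (v t)))))"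
    if "z \<in> ball 0 1" for z
    unfolding h[OF that] exp_add[symmetric] ln_exp using H(2)[OF that] by simp
  then show ?thesis
    unfolding outer_function_def using H(1) m
    by (intro exI[of _ "exp (\<i> * of_real (Im (u 0)))"] exI[of _ "\<lambda>t. exp (v t)"]) auto
qed

section \<open>Inner functions\<close>

lemma inner_AE_norm_tendsto:
  assumes "inner_function J"
  shows "AE t in lebesgue_on {0..2 * pi}. (\<lambda>n. cmod (J (of_real (radius n) * cis t))) \<longlonglongrightarrow> 1"
proof -
  have "AE t in lebesgue_on {0..2 * pi}. \<exists>w. has_boundary_value J t w \<and> cmod w = 1"
    using assms by (simp add: inner_function_def)
  then show ?thesis
  proof eventually_elim
    case (elim t)
    then obtain w where w: "has_boundary_value J t w" "cmod w = 1" by blast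
    from tendsto_norm[OF has_boundary_value_sequence[OF w(1) radius_tendsto]] radius_in w(2)
    show ?case by auto
  qed
qed

text \<open>
Cauchy's estimate for \<open>J\<^sup>k\<close> at the boundary gives \<open>(1 - \<bar>z\<bar>) * \<bar>J z\<bar>\<^sup>k \<le> 1\<close> for every \<open>k\<close>, which
fails for large \<open>k\<close> if \<open>\<bar>J z\<bar> > 1\<close>.
\<close>

lemma inner_norm_le_1:
  assumes J: "inner_function J" and z: "z \<in> ball 0 1"
  shows "cmod (J z) \<le> 1"
proof (rule ccontr)
  assume "\<not> cmod (J z) \<le> 1"
  then have big: "1 < cmod (J z)" by simp
  obtain C where C: "J holomorphic_on ball 0 1" "\<And>z. z \<in> ball 0 1 \<Longrightarrow> cmod (J z) \<le> C"
    using J hardy_infinity_bound unfolding inner_function_def by metis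
  have cJ: "continuous_on (ball 0 1) J" using C(1) holomorphic_on_imp_continuous_on by blast
  have bound: "(1 - cmod z) * cmod (J z) ^ k \<le> 1" for k
  proof -
    have "AE t in lebesgue_on {0..2 * pi}. (\<lambda>n. cmod (J (of_real (radius n) * cis t) ^ k)) \<longlonglongrightarrow> 1"
      using inner_AE_norm_tendsto[OF J]
    proof eventually_elim
      case (elim t)
      from tendsto_power[OF this, of k] show ?case by (simp add: norm_power)
    qed
    then have lim: "(\<lambda>n. circle_mean (\<lambda>w. cmod (J w ^ k)) (radius n)) \<longlonglongrightarrow> 1"
      by (rule circle_mean_tendsto_const[where C = "C ^ k", rotated 3])
         (use C radius_in in \<open>auto intro!: continuous_intros cJ power_mono simp: norm_power\<close>)
    have liml: "(\<lambda>n. (radius n - cmod z) * cmod (J z ^ k)) \<longlonglongrightarrow> (1 - cmod z) * cmod (J z ^ k)"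
      by (intro tendsto_intros radius_tendsto)
    have ev: "eventually (\<lambda>n. cmod z < radius n) sequentially"
      using z by (intro order_tendstoD(1)[OF radius_tendsto]) auto
    then have "eventually (\<lambda>n. (radius n - cmod z) * cmod (J z ^ k)
        \<le> circle_mean (\<lambda>w. cmod (J w ^ k)) (radius n)) sequentially"
      by eventually_elim
         (use C(1) radius_in in \<open>auto intro!: holomorphic_le_circle_mean holomorphic_intros\<close>)
    from tendsto_le[OF _ lim liml this] show ?thesis by (simp add: norm_power)
  qed
  obtain k where "1 / (1 - cmod z) < cmod (J z) ^ k" using real_arch_pow[OF big] by blast
  then have "1 < (1 - cmod z) * cmod (J z) ^ k" using z by (simp add: field_simps)
  then show False using bound[of k] by simp
qed

lemma inner_compose_radial_limits:
  assumes J: "inner_function J" and \<Phi>: "\<Phi> holomorphic_on S" "open S" "cball 0 1 \<subseteq> S"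
  shows "bounded_with_radial_limits (\<lambda>z. \<Phi> (J z))"
proof -
  have Jh: "J holomorphic_on ball 0 1" using J by (simp add: inner_function_def hardy_infinity_def)
  have img: "J ` ball 0 1 \<subseteq> cball 0 1" using inner_norm_le_1[OF J] by auto
  have c: "continuous_on (cball 0 1) \<Phi>"
    using \<Phi> holomorphic_on_imp_continuous_on continuous_on_subset by blast
  have "bounded (\<Phi> ` cball 0 1)"
    by (intro compact_imp_bounded compact_continuous_image c compact_cball)
  then have "bounded ((\<lambda>z. \<Phi> (J z)) ` ball 0 1)"
    by (rule bounded_subset) (use img in auto)
  moreover have "(\<lambda>z. \<Phi> (J z)) holomorphic_on ball 0 1"
    by (rule holomorphic_on_compose_gen[OF Jh \<Phi>(1), unfolded o_def]) (use img \<Phi>(3) in auto)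
  moreover have "AE t in lebesgue_on {0..2 * pi}. \<exists>w. has_boundary_value J t w \<and> cmod w = 1"
    using J by (simp add: inner_function_def)
  then have "AE t in lebesgue_on {0..2 * pi}. \<exists>w. has_boundary_value (\<lambda>z. \<Phi> (J z)) t w"
  proof eventually_elim
    case (elim t)
    then obtain w where w: "has_boundary_value J t w" "cmod w = 1" by blast
    then have "isCont \<Phi> w"
      using \<Phi> holomorphic_on_imp_continuous_on[OF \<Phi>(1)] subsetD[OF \<Phi>(3), of w]
      by (simp add: continuous_on_eq_continuous_at)
    from isCont_tendsto_compose[OF this w(1)[unfolded has_boundary_value_def]]
    show ?case by (auto simp: has_boundary_value_def)
  qed
  ultimately show ?thesis by (simp add: bounded_with_radial_limits_def hardy_infinity_def)
qed

section \<open>The extremal problem\<close>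

text \<open>
The function \<open>(1 - (1 - cnj a * w) powr q) / w\<close> on the half-plane where \<open>1 - cnj a * w\<close> has positive real
part. It has no zeros: the argument of \<open>1 - cnj a * w\<close> is less than \<open>pi / 2\<close>, so multiplying by
\<open>q < 2\<close> keeps it below \<open>pi\<close>, and the power equals \<open>1\<close> only at \<open>w = 0\<close>, where the quotient has the
value \<open>q * cnj a\<close>. A zero-free function on a convex set is an exponential.
\<close>

lemma extremal_generator:
  assumes a: "a \<noteq> 0" "cmod a < 1" and q: "0 < q" "q < 2"
  obtains S U where "open S" "cball 0 1 \<subseteq> S" "U holomorphic_on S"
    "\<forall>w\<in>S. w * exp (U w) = 1 - exp (of_real q * Ln (1 - cnj a * w))"
proof -
  define S where "S = {w. Re (cnj a * w) < 1}"
  have S_eq: "S = {w. a \<bullet> w < 1}" by (auto simp: S_def inner_complex_def)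
  have S: "open S" "convex S" unfolding S_eq by (rule open_halfspace_lt, rule convex_halfspace_lt)
  have sub: "cball 0 1 \<subseteq> S"
  proof
    fix w :: complex assume "w \<in> cball 0 1"
    then have "cmod (cnj a * w) \<le> cmod a" using mult_left_le[of "cmod w" "cmod a"] by (simp add: norm_mult)
    then show "w \<in> S" unfolding S_def using a complex_Re_le_cmod[of "cnj a * w"] by simp
  qed
  have pos: "0 < Re (1 - cnj a * w)" if "w \<in> S" for w using that by (simp add: S_def)
  then have nonneg: "1 - cnj a * w \<notin> \<real>\<^sub>\<le>\<^sub>0" if "w \<in> S" for w
    using that by (auto simp: complex_nonpos_Reals_iff simp del: minus_complex.sel times_complex.sel)
      (meson not_le)
  define f where "f w = 1 - exp (of_real q * Ln (1 - cnj a * w))" for w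
  have f: "f holomorphic_on S" unfolding f_def using nonneg by (intro holomorphic_intros) auto
  have f0: "f 0 = 0" by (simp add: f_def)
  have S0: "0 \<in> S" by (simp add: S_def)
  define g where "g w = (if w = 0 then deriv f 0 else (f w - f 0) / (w - 0))" for w
  have g: "g holomorphic_on S"
    unfolding g_def[abs_def] by (rule pole_lemma[OF f]) (use S S0 in \<open>simp add: interior_open\<close>)
  have "(f has_field_derivative of_real q * cnj a) (at 0)"
    unfolding f_def[abs_def] by (auto intro!: derivative_eq_intros)
  then have d: "deriv f 0 = of_real q * cnj a" by (rule DERIV_imp_deriv)
  have g_nz: "g w \<noteq> 0" if w: "w \<in> S" for w
  proof (cases "w = 0")
    case True
    then show ?thesis using a q by (simp add: g_def d)
  next
    case False
    have "f w \<noteq> 0"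
    proof
      assume "f w = 0"
      then have "exp (of_real q * Ln (1 - cnj a * w)) = 1" by (simp add: f_def)
      then obtain n :: int where n: "q * Re (Ln (1 - cnj a * w)) = 0"
          "q * Im (Ln (1 - cnj a * w)) = of_int (2 * n) * pi"
        by (auto simp: exp_eq_1)
      have nz: "1 - cnj a * w \<noteq> 0" using pos[OF w] by (metis less_irrefl zero_complex.sel(1))
      have "\<bar>Im (Ln (1 - cnj a * w))\<bar> < pi / 2" using Re_Ln_pos_lt[OF nz] pos[OF w] by blast
      then have "q * \<bar>Im (Ln (1 - cnj a * w))\<bar> < 2 * (pi / 2)"
        using q by (intro mult_strict_mono) auto
      moreover have "q * \<bar>Im (Ln (1 - cnj a * w))\<bar> = \<bar>of_int (2 * n) * pi\<bar>"
        unfolding n(2)[symmetric] using q by (simp only: abs_mult abs_of_pos)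
      ultimately have "\<bar>real_of_int (2 * n)\<bar> * pi < 1 * pi" by (simp only: abs_mult) simp
      then have "\<bar>real_of_int (2 * n)\<bar> < 1" using mult_less_cancel_right_pos[OF pi_gt_zero] by blast
      then have "n = 0" by linarith
      then have "Ln (1 - cnj a * w) = 0" using n q by (simp add: complex_eq_iff)
      then have "1 - cnj a * w = 1" using exp_Ln[OF nz] by simp
      then show False using False a by simp
    qed
    then show ?thesis using False by (simp add: g_def f0)
  qed
  obtain U where U: "U holomorphic_on S" "\<And>w. w \<in> S \<Longrightarrow> exp (U w) = g w"
    using holomorphic_logarithm_exists[OF S(2,1) g g_nz S0] by metis
  show thesis
  proof (rule that[OF S(1) sub U(1)], rule ballI)
    fix w assume "w \<in> S"
    then show "w * exp (U w) = 1 - exp (of_real q * Ln (1 - cnj a * w))"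
      using f0 by (cases "w = 0") (auto simp: U(2) g_def f_def)
  qed
qed

lemma inner_holomorphic: "inner_function J \<Longrightarrow> J holomorphic_on ball 0 1"
  by (simp add: inner_function_def hardy_infinity_def)

lemma mean_norm_sq_tendsto:
  assumes "inner_function J"
  shows "(\<lambda>n. circle_mean (\<lambda>z. (cmod (J z))\<^sup>2) (radius n)) \<longlonglongrightarrow> 1"
proof -
  have c: "continuous_on (ball 0 1) J"
    using inner_holomorphic[OF assms] holomorphic_on_imp_continuous_on by blast
  have "AE t in lebesgue_on {0..2 * pi}. (\<lambda>n. (cmod (J (of_real (radius n) * cis t)))\<^sup>2) \<longlonglongrightarrow> 1"
    using inner_AE_norm_tendsto[OF assms]
  proof eventually_elim
    case (elim t)
    from tendsto_power[OF this, of 2] show ?case by simp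
  qed
  then show ?thesis
    by (rule circle_mean_tendsto_const[where C = 1, rotated 3])
       (use radius_in inner_norm_le_1[OF assms] in \<open>auto intro!: continuous_intros c power_le_one\<close>)
qed

text \<open>
Expand the square; the mixed term is the real part of a holomorphic function, with mean \<open>\<bar>J 0\<bar>\<^sup>2\<close>.
\<close>

lemma circle_mean_weight:
  assumes J: "J holomorphic_on ball 0 1" and r: "r \<in> {0<..<1}"
  shows "circle_mean (\<lambda>z. (cmod (1 - cnj (J 0) * J z))\<^sup>2) r =
    1 - 2 * (cmod (J 0))\<^sup>2 + (cmod (J 0))\<^sup>2 * circle_mean (\<lambda>z. (cmod (J z))\<^sup>2) r"
proof -
  let ?a = "J 0"
  have c: "continuous_on (ball 0 1) J" using J holomorphic_on_imp_continuous_on by blast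
  have sq: "(cmod (1 - cnj ?a * w))\<^sup>2 = 1 + - 2 * Re (cnj ?a * w) + (cmod ?a)\<^sup>2 * (cmod w)\<^sup>2" for w
    by (simp only: cmod_power2) (simp add: power2_eq_square algebra_simps)
  have "circle_mean (\<lambda>z. Re (cnj ?a * J z)) r = Re (circle_mean (\<lambda>z. cnj ?a * J z) r)"
    by (rule circle_mean_Re[symmetric]) (intro continuous_intros c r)+
  also have "\<dots> = Re (cnj ?a * ?a)"
    by (subst mean_value_property) (intro holomorphic_intros J r refl)+
  also have "\<dots> = (cmod ?a)\<^sup>2" by (simp only: cmod_power2) (simp add: power2_eq_square)
  finally have R: "circle_mean (\<lambda>z. Re (cnj ?a * J z)) r = (cmod ?a)\<^sup>2" .
  have "circle_mean (\<lambda>z. (cmod (1 - cnj ?a * J z))\<^sup>2) r =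
      circle_mean (\<lambda>z. 1 + - 2 * Re (cnj ?a * J z)) r + circle_mean (\<lambda>z. (cmod ?a)\<^sup>2 * (cmod (J z))\<^sup>2) r"
    unfolding sq by (intro circle_mean_add r continuous_intros c)
  also have "circle_mean (\<lambda>z. 1 + - 2 * Re (cnj ?a * J z)) r =
      circle_mean (\<lambda>z. 1) r + circle_mean (\<lambda>z. - 2 * Re (cnj ?a * J z)) r"
    by (intro circle_mean_add r continuous_intros c)
  finally show ?thesis unfolding circle_mean_cmult circle_mean_const R by simp
qed

text \<open>
Where \<open>\<bar>k\<bar>\<close> is below a large threshold \<open>T\<close>, the mean of \<open>1 - \<bar>J\<bar>\<^sup>2\<close> tends to zero; the
remaining part is at most \<open>T powr (1 - p)\<close> times the \<open>p\<close>-th power of the norm of \<open>k\<close>.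
\<close>

lemma mean_defect_times_hardy_tendsto:
  assumes J: "inner_function J" and p: "1 < p" and k: "k \<in> hardy_space p"
  shows "(\<lambda>n. circle_mean (\<lambda>z. (1 - (cmod (J z))\<^sup>2) * cmod (k z)) (radius n)) \<longlonglongrightarrow> 0"
proof (rule LIMSEQ_I)
  fix e :: real assume e: "0 < e"
  define A where "A = hardy_norm p k powr p"
  have p0: "0 < p" using p by simp
  have cJ: "continuous_on (ball 0 1) J"
    using inner_holomorphic[OF J] holomorphic_on_imp_continuous_on by blast
  have ck: "continuous_on (ball 0 1) k" by (rule hardy_space_continuous[OF k])
  have A0: "0 \<le> A" by (simp add: A_def)
  have "((\<lambda>T. T powr (1 - p) * A) \<longlongrightarrow> 0 * A) at_top"
    by (intro tendsto_mult tendsto_const tendsto_neg_powr filterlim_ident) (use p in auto)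
  then have "eventually (\<lambda>T. T powr (1 - p) * A < e / 2) at_top"
    using e by (intro order_tendstoD(2)) auto
  then have "eventually (\<lambda>T. T powr (1 - p) * A < e / 2 \<and> 0 < T) at_top"
    using eventually_gt_at_top[of 0] by (rule eventually_conj)
  then obtain T where T: "T powr (1 - p) * A < e / 2" "0 < T"
    using eventually_happens'[OF trivial_limit_at_top_linorder] by blast
  have lim: "(\<lambda>n. T * (1 - circle_mean (\<lambda>z. (cmod (J z))\<^sup>2) (radius n))) \<longlonglongrightarrow> T * (1 - 1)"
    by (intro tendsto_intros mean_norm_sq_tendsto J)
  have "eventually (\<lambda>n. T * (1 - circle_mean (\<lambda>z. (cmod (J z))\<^sup>2) (radius n)) < e / 2) sequentially"
    by (rule order_tendstoD(2)[OF lim]) (use e in auto)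
  then obtain N where N: "\<And>n. N \<le> n \<Longrightarrow> T * (1 - circle_mean (\<lambda>z. (cmod (J z))\<^sup>2) (radius n)) < e / 2"
    unfolding eventually_sequentially by blast
  show "\<exists>N. \<forall>n\<ge>N. norm (circle_mean (\<lambda>z. (1 - (cmod (J z))\<^sup>2) * cmod (k z)) (radius n) - 0) < e"
  proof (intro exI allI impI)
    fix n assume n: "N \<le> n"
    let ?r = "radius n"
    have s: "0 \<le> 1 - (cmod (J z))\<^sup>2" "1 - (cmod (J z))\<^sup>2 \<le> 1" if "z \<in> ball 0 1" for z
      using inner_norm_le_1[OF J that] by (auto intro: power_le_one)
    have "0 = circle_mean (\<lambda>z. 0 :: real) ?r" by (simp add: circle_mean_const)
    also have "\<dots> \<le> circle_mean (\<lambda>z. (1 - (cmod (J z))\<^sup>2) * cmod (k z)) ?r"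
      by (intro circle_mean_mono radius_in continuous_intros cJ ck mult_nonneg_nonneg s norm_ge_zero)
    finally have ge: "0 \<le> circle_mean (\<lambda>z. (1 - (cmod (J z))\<^sup>2) * cmod (k z)) ?r" .
    have "circle_mean (\<lambda>z. (1 - (cmod (J z))\<^sup>2) * cmod (k z)) ?r \<le>
        circle_mean (\<lambda>z. T + - T * (cmod (J z))\<^sup>2 + T powr (1 - p) * cmod (k z) powr p) ?r"
    proof (intro circle_mean_mono radius_in continuous_on_cmod_powr continuous_intros cJ ck p0)
      fix z :: complex assume z: "z \<in> ball 0 1"
      have "(1 - (cmod (J z))\<^sup>2) * cmod (k z) \<le>
          (1 - (cmod (J z))\<^sup>2) * (T + T powr (1 - p) * cmod (k z) powr p)"
        by (intro mult_left_mono le_threshold_powr T p s(1) z norm_ge_zero)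
      also have "\<dots> \<le> (1 - (cmod (J z))\<^sup>2) * T + 1 * (T powr (1 - p) * cmod (k z) powr p)"
        unfolding distrib_left by (intro add_left_mono mult_right_mono s(2) z) auto
      finally show "(1 - (cmod (J z))\<^sup>2) * cmod (k z) \<le>
          T + - T * (cmod (J z))\<^sup>2 + T powr (1 - p) * cmod (k z) powr p"
        by (simp add: algebra_simps)
    qed
    also have "\<dots> = circle_mean (\<lambda>z. T + - T * (cmod (J z))\<^sup>2) ?r + T powr (1 - p) * hardy_mean p k ?r"
      unfolding hardy_mean_eq_circle_mean circle_mean_cmult[symmetric]
      by (intro circle_mean_add radius_in continuous_on_cmod_powr continuous_intros cJ ck p0)
    also have "circle_mean (\<lambda>z. T + - T * (cmod (J z))\<^sup>2) ?r =
        T * (1 - circle_mean (\<lambda>z. (cmod (J z))\<^sup>2) ?r)"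
    proof -
      have "circle_mean (\<lambda>z. T + - T * (cmod (J z))\<^sup>2) ?r =
          circle_mean (\<lambda>z. T) ?r + circle_mean (\<lambda>z. - T * (cmod (J z))\<^sup>2) ?r"
        by (intro circle_mean_add radius_in continuous_intros cJ)
      then show ?thesis unfolding circle_mean_cmult circle_mean_const by (simp add: algebra_simps)
    qed
    also have "T powr (1 - p) * hardy_mean p k ?r \<le> T powr (1 - p) * A"
      unfolding A_def by (intro mult_left_mono hardy_mean_le_norm_powr p0 k radius_in) auto
    finally show "norm (circle_mean (\<lambda>z. (1 - (cmod (J z))\<^sup>2) * cmod (k z)) (radius n) - 0) < e"
      using ge N[OF n] T(1) by simp
  qed
qed

lemma inner_weight_pos:
  assumes "inner_function J" "cmod (J 0) < 1" "z \<in> ball 0 1"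
  shows "1 - cmod (J 0) \<le> cmod (1 - cnj (J 0) * J z)" "cmod (1 - cnj (J 0) * J z) \<le> 2"
proof -
  have "cmod (cnj (J 0) * J z) \<le> cmod (J 0)"
    using mult_left_le[OF inner_norm_le_1[OF assms(1,3)], of "cmod (J 0)"] by (simp add: norm_mult)
  then show "1 - cmod (J 0) \<le> cmod (1 - cnj (J 0) * J z)" "cmod (1 - cnj (J 0) * J z) \<le> 2"
    using norm_triangle_ineq2[of 1 "cnj (J 0) * J z"] norm_triangle_ineq4[of 1 "cnj (J 0) * J z"] assms(2)
    by auto
qed

text \<open>
On the unit circle \<open>J * cnj (1 - cnj a * J) = J - a\<close>, which vanishes at \<open>0\<close> because \<open>a = J 0\<close>. This is
the orthogonality relation for the minimiser. Inside the disk the identity has the error term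
\<open>a * (1 - \<bar>J\<bar>\<^sup>2)\<close>, which is \<open>g\<close> in the proof up to the factors \<open>K\<close> and \<open>k\<close>.
\<close>

lemma dual_extremal_annihilates:
  fixes a :: complex
  assumes J: "inner_function J" and p: "1 < p" and k: "k \<in> hardy_space p" and a: "a = J 0"
    and F: "F holomorphic_on ball 0 1" "\<And>z. z \<in> ball 0 1 \<Longrightarrow> F z \<noteq> 0"
    and B: "\<And>z. z \<in> ball 0 1 \<Longrightarrow> cmod ((1 - cnj a * J z) / F z) \<le> B"
  shows "(\<lambda>n. circle_mean (\<lambda>z. (cmod (1 - cnj a * J z))\<^sup>2 * Re (J z * k z / F z)) (radius n)) \<longlonglongrightarrow> 0"
proof -
  have Jh: "J holomorphic_on ball 0 1" by (rule inner_holomorphic[OF J])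
  have kh: "k holomorphic_on ball 0 1" using k by (simp add: hardy_space_def)
  note c = Jh[THEN holomorphic_on_imp_continuous_on] kh[THEN holomorphic_on_imp_continuous_on]
    F(1)[THEN holomorphic_on_imp_continuous_on]
  define K where "K z = (1 - cnj a * J z) / F z" for z
  have Kh: "K holomorphic_on ball 0 1"
    unfolding K_def[abs_def] by (intro holomorphic_intros Jh F) (use F(2) in auto)
  note cK = Kh[THEN holomorphic_on_imp_continuous_on]
  define g where "g z = Re (a * (1 - (cmod (J z))\<^sup>2) * K z * k z)" for z
  have cg: "continuous_on (ball 0 1) g"
    unfolding g_def[abs_def] by (intro continuous_intros c cK)
  have split: "(cmod (1 - cnj a * J z))\<^sup>2 * Re (J z * k z / F z) = Re (K z * (J z - a) * k z) + g z" for z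
  proof -
    have "complex_of_real ((cmod (1 - cnj a * J z))\<^sup>2) * (J z * k z / F z) =
        (1 - cnj a * J z) * cnj (1 - cnj a * J z) * (J z * k z / F z)"
      by (simp only: complex_norm_square)
    also have "\<dots> = K z * ((1 - a * cnj (J z)) * J z) * k z"
      by (simp add: K_def)
    also have "(1 - a * cnj (J z)) * J z = (J z - a) + a * (1 - of_real ((cmod (J z))\<^sup>2))"
      unfolding complex_norm_square by (simp add: algebra_simps)
    finally have "complex_of_real ((cmod (1 - cnj a * J z))\<^sup>2) * (J z * k z / F z) =
        K z * (J z - a) * k z + a * (1 - (cmod (J z))\<^sup>2) * K z * k z"
      by (simp add: algebra_simps)
    moreover have "Re (of_real x * y) = x * Re y" for x y by simp
    ultimately show ?thesis by (metis g_def plus_complex.sel(1))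
  qed
  have mean: "circle_mean (\<lambda>z. (cmod (1 - cnj a * J z))\<^sup>2 * Re (J z * k z / F z)) r = circle_mean g r"
    if r: "r \<in> {0<..<1}" for r
  proof -
    have "circle_mean (\<lambda>z. Re (K z * (J z - a) * k z)) r = Re (circle_mean (\<lambda>z. K z * (J z - a) * k z) r)"
      by (rule circle_mean_Re[symmetric]) (intro continuous_intros c cK r)+
    also have "circle_mean (\<lambda>z. K z * (J z - a) * k z) r = K 0 * (J 0 - a) * k 0"
      by (rule mean_value_property) (intro holomorphic_intros Kh Jh kh r)+
    finally have 0: "circle_mean (\<lambda>z. Re (K z * (J z - a) * k z)) r = 0" by (simp add: a)
    have "circle_mean (\<lambda>z. Re (K z * (J z - a) * k z) + g z) r =
        circle_mean (\<lambda>z. Re (K z * (J z - a) * k z)) r + circle_mean g r"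
      by (intro circle_mean_add continuous_intros c cK cg r)
    then show ?thesis unfolding split 0 by simp
  qed
  have B0: "0 \<le> B" using order_trans[OF norm_ge_zero B[of 0]] by simp
  have g_le: "\<bar>g z\<bar> \<le> cmod a * B * ((1 - (cmod (J z))\<^sup>2) * cmod (k z))" if z: "z \<in> ball 0 1" for z
  proof -
    have s: "0 \<le> 1 - (cmod (J z))\<^sup>2" using inner_norm_le_1[OF J z] by (auto intro: power_le_one)
    have "\<bar>g z\<bar> \<le> cmod (a * of_real (1 - (cmod (J z))\<^sup>2) * K z * k z)"
      unfolding g_def using abs_Re_le_cmod by (metis of_real_1 of_real_diff)
    also have "\<dots> = cmod a * cmod (K z) * ((1 - (cmod (J z))\<^sup>2) * cmod (k z))"
      using s by (simp only: norm_mult norm_of_real abs_of_nonneg) simp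
    also have "\<dots> \<le> cmod a * B * ((1 - (cmod (J z))\<^sup>2) * cmod (k z))"
      using s B[OF z] by (intro mult_right_mono mult_left_mono) (auto simp: K_def)
    finally show ?thesis .
  qed
  have bound: "\<bar>circle_mean g (radius n)\<bar> \<le>
      cmod a * B * circle_mean (\<lambda>z. (1 - (cmod (J z))\<^sup>2) * cmod (k z)) (radius n)" for n
  proof -
    have "circle_mean g (radius n) \<le> circle_mean (\<lambda>z. cmod a * B * ((1 - (cmod (J z))\<^sup>2) * cmod (k z))) (radius n)"
      by (intro circle_mean_mono radius_in cg continuous_intros c order_trans[OF abs_ge_self g_le])
    moreover have "circle_mean (\<lambda>z. -1 * g z) (radius n) \<le>
        circle_mean (\<lambda>z. cmod a * B * ((1 - (cmod (J z))\<^sup>2) * cmod (k z))) (radius n)"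
      by (intro circle_mean_mono radius_in cg continuous_intros c order_trans[OF _ g_le]) auto
    ultimately show ?thesis unfolding circle_mean_cmult by linarith
  qed
  have "(\<lambda>n. cmod a * B * circle_mean (\<lambda>z. (1 - (cmod (J z))\<^sup>2) * cmod (k z)) (radius n))
      \<longlonglongrightarrow> cmod a * B * 0"
    by (intro tendsto_intros mean_defect_times_hardy_tendsto[OF J p k])
  then have lim0: "(\<lambda>n. cmod a * B * circle_mean (\<lambda>z. (1 - (cmod (J z))\<^sup>2) * cmod (k z)) (radius n)) \<longlonglongrightarrow> 0"
    by (simp only: mult_zero_right)
  have "(\<lambda>n. circle_mean g (radius n)) \<longlonglongrightarrow> 0"
    by (rule Lim_null_comparison[OF always_eventually[OF allI] lim0]) (simp only: real_norm_def bound)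
  then show ?thesis unfolding mean[OF radius_in] .
qed

lemma holomorphic_mult_eq_0:
  assumes "J holomorphic_on ball 0 1" "k holomorphic_on ball 0 1" "J 0 \<noteq> 0"
    and "\<And>z. z \<in> ball 0 1 \<Longrightarrow> J z * k z = 0" and z: "z \<in> ball (0::complex) 1"
  shows "k z = 0"
proof -
  define T where "T = {z \<in> ball 0 1. J z \<noteq> 0}"
  have "open T"
    using continuous_open_preimage[of "ball 0 1" J "- {0}"] assms(1) holomorphic_on_imp_continuous_on
    by (auto simp: T_def vimage_def Int_def)
  moreover have "T \<noteq> {}" using assms(3) by (auto simp: T_def intro!: exI[of _ 0])
  ultimately show ?thesis
    by (rule analytic_continuation_open[where s' = "ball 0 1" and f = k and g = "\<lambda>_. 0", simplified])
       (use assms in \<open>auto simp: T_def\<close>)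
qed

text \<open>
With \<open>w = J k / F\<close> the mean of \<open>\<bar>F - J k\<bar>\<^sup>p\<close> is the mean of
\<open>W * (1 - p * Re w + tangent_gap p w)\<close>. In the limit the first term gives \<open>1 - \<bar>a\<bar>\<^sup>2\<close> and the second
one vanishes, so the mean gap is at most the excess of the \<open>p\<close>-th power of the norm over its minimum. In the case of
equality the gap, and with it the first mean of \<open>w\<close>, tends to zero.
\<close>

lemma extremal_variation:
  fixes a :: complex
  assumes J: "inner_function J" and p: "1 < p" and k: "k \<in> hardy_space p" and a: "a = J 0" "cmod a < 1"
    and F: "F holomorphic_on ball 0 1"
      "\<And>z. z \<in> ball 0 1 \<Longrightarrow> cmod (F z) powr p = (cmod (1 - cnj a * J z))\<^sup>2"
    and FJk: "(\<lambda>z. F z - J z * k z) \<in> hardy_space p"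
  shows extremal_lower_bound: "1 - (cmod a)\<^sup>2 \<le> hardy_norm p (\<lambda>z. F z - J z * k z) powr p"
    and extremal_unique: "hardy_norm p (\<lambda>z. F z - J z * k z) powr p = 1 - (cmod a)\<^sup>2 \<Longrightarrow>
      z \<in> ball 0 1 \<Longrightarrow> J z * k z = 0"
proof -
  have p0: "0 < p" using p by simp
  have Jh: "J holomorphic_on ball 0 1" by (rule inner_holomorphic[OF J])
  have kh: "k holomorphic_on ball 0 1" using k by (simp add: hardy_space_def)
  define W where "W z = (cmod (1 - cnj a * J z))\<^sup>2" for z
  \<comment> \<open>A positive lower bound of the weight \<open>W\<close>, which also bounds \<open>1 / F\<close>.\<close>
  define m where "m = (1 - cmod a)\<^sup>2"
  have m: "0 < m" using a(2) by (simp add: m_def)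
  have Wm: "m \<le> W z" if "z \<in> ball 0 1" for z
    unfolding W_def m_def using inner_weight_pos(1)[OF J _ that] a by (intro power_mono) auto
  have F0: "F z \<noteq> 0" if "z \<in> ball 0 1" for z
    using F(2)[OF that] Wm[OF that] m p0 by (auto simp: W_def)
  note c = Jh[THEN holomorphic_on_imp_continuous_on] kh[THEN holomorphic_on_imp_continuous_on]
    F(1)[THEN holomorphic_on_imp_continuous_on]
  have cW: "continuous_on (ball 0 1) W" unfolding W_def[abs_def] by (intro continuous_intros c)
  define w where "w z = J z * k z / F z" for z
  have wh: "w holomorphic_on ball 0 1"
    unfolding w_def[abs_def] by (intro holomorphic_intros Jh kh F) (use F0 in auto)
  note cw = wh[THEN holomorphic_on_imp_continuous_on]
  have "m powr (1 / p) \<le> cmod (F z)" if "z \<in> ball 0 1" for z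
  proof -
    have "m powr (1 / p) \<le> (cmod (F z) powr p) powr (1 / p)"
      using Wm[OF that] m p0 unfolding F(2)[OF that] W_def by (intro powr_mono2) auto
    then show ?thesis using p0 by (simp add: powr_powr)
  qed
  then have "cmod ((1 - cnj a * J z) / F z) \<le> 2 / m powr (1 / p)" if "z \<in> ball 0 1" for z
    using inner_weight_pos(2)[OF J _ that] a m that unfolding norm_divide by (intro frac_le) auto
  from dual_extremal_annihilates[OF J p k a(1) F(1) F0 this]
  have lim0: "(\<lambda>n. circle_mean (\<lambda>z. W z * Re (w z)) (radius n)) \<longlonglongrightarrow> 0"
    by (simp add: W_def w_def)
  have "(\<lambda>n. 1 - 2 * (cmod a)\<^sup>2 + (cmod a)\<^sup>2 * circle_mean (\<lambda>z. (cmod (J z))\<^sup>2) (radius n))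
      \<longlonglongrightarrow> 1 - 2 * (cmod a)\<^sup>2 + (cmod a)\<^sup>2 * 1"
    by (intro tendsto_intros mean_norm_sq_tendsto J)
  then have limW: "(\<lambda>n. circle_mean W (radius n)) \<longlonglongrightarrow> 1 - (cmod a)\<^sup>2"
    unfolding W_def[abs_def] a(1) using circle_mean_weight[OF Jh radius_in] by simp
  define N where "N = hardy_norm p (\<lambda>z. F z - J z * k z) powr p"
  define G where "G n = circle_mean (\<lambda>z. W z * tangent_gap p (w z)) (radius n)" for n
  have cG: "continuous_on (ball 0 1) (\<lambda>z. W z * tangent_gap p (w z))"
    by (intro continuous_intros continuous_on_tangent_gap cW cw p0)
  have G_le: "G n \<le> N - circle_mean W (radius n) + p * circle_mean (\<lambda>z. W z * Re (w z)) (radius n)" for n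
  proof -
    have "circle_mean W (radius n) + G n =
        circle_mean (\<lambda>z. W z + W z * tangent_gap p (w z)) (radius n)"
      unfolding G_def by (intro circle_mean_add[symmetric] radius_in cW cG)
    also have "\<dots> = circle_mean (\<lambda>z. cmod (F z - J z * k z) powr p + p * (W z * Re (w z))) (radius n)"
    proof (rule circle_mean_cong[OF radius_in])
      fix z :: complex assume z: "z \<in> ball 0 1"
      have "F z - J z * k z = F z * (1 - w z)" using F0[OF z] by (simp add: w_def field_simps)
      then have "cmod (F z - J z * k z) powr p = W z * cmod (1 - w z) powr p"
        using F(2)[OF z] by (simp add: norm_mult powr_mult W_def)
      then show "W z + W z * tangent_gap p (w z) = cmod (F z - J z * k z) powr p + p * (W z * Re (w z))"
        by (simp add: tangent_gap_def algebra_simps)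
    qed
    also have "\<dots> = hardy_mean p (\<lambda>z. F z - J z * k z) (radius n) +
        p * circle_mean (\<lambda>z. W z * Re (w z)) (radius n)"
      unfolding hardy_mean_eq_circle_mean circle_mean_cmult[symmetric]
      by (intro circle_mean_add radius_in continuous_on_cmod_powr continuous_intros c cW cw p0)
    also have "hardy_mean p (\<lambda>z. F z - J z * k z) (radius n) \<le> N"
      unfolding N_def by (rule hardy_mean_le_norm_powr[OF p0 FJk radius_in])
    finally show ?thesis by simp
  qed
  have lim: "(\<lambda>n. N - circle_mean W (radius n) + p * circle_mean (\<lambda>z. W z * Re (w z)) (radius n))
      \<longlonglongrightarrow> N - (1 - (cmod a)\<^sup>2) + p * 0"
    by (intro tendsto_intros limW lim0)
  have G0: "0 \<le> G n" for n
  proof -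
    have "circle_mean (\<lambda>z. 0) (radius n) \<le> G n"
      unfolding G_def using tangent_gap_nonneg[OF p]
      by (intro circle_mean_mono radius_in cG) (auto simp: W_def)
    then show ?thesis by (simp add: circle_mean_const)
  qed
  have "0 \<le> N - (1 - (cmod a)\<^sup>2) + p * 0"
    by (rule LIMSEQ_le_const[OF lim]) (use order_trans[OF G0 G_le] in auto)
  then show "1 - (cmod a)\<^sup>2 \<le> hardy_norm p (\<lambda>z. F z - J z * k z) powr p" by (simp add: N_def)
  assume eq: "hardy_norm p (\<lambda>z. F z - J z * k z) powr p = 1 - (cmod a)\<^sup>2" and z: "z \<in> ball 0 1"
  have limG: "G \<longlonglongrightarrow> 0"
    by (rule tendsto_sandwich[OF _ _ tendsto_const lim[folded N_def, unfolded eq[folded N_def]], simplified])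
       (use G0 G_le eq in \<open>auto simp: N_def\<close>)
  have "(1 - cmod z) * cmod (w z) \<le> 0 + \<delta>" if \<delta>: "0 < \<delta>" for \<delta>
  proof -
    obtain C where C: "0 \<le> C" "\<And>w. cmod w \<le> \<delta> + C * tangent_gap p w"
      using norm_le_tangent_gap[OF p \<delta>] by metis
    have mean_w: "circle_mean (\<lambda>z. cmod (w z)) (radius n) \<le> \<delta> + C / m * G n" for n
    proof -
      have "circle_mean (\<lambda>z. cmod (w z)) (radius n) \<le>
          circle_mean (\<lambda>z. \<delta> + C / m * (W z * tangent_gap p (w z))) (radius n)"
      proof (intro circle_mean_mono radius_in continuous_intros continuous_on_tangent_gap cw cW p0)
        fix z :: complex assume z: "z \<in> ball 0 1"
        have "cmod (w z) \<le> \<delta> + C / m * (m * tangent_gap p (w z))" using C(2)[of "w z"] m by simp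
        also have "\<dots> \<le> \<delta> + C / m * (W z * tangent_gap p (w z))"
          using C(1) m Wm[OF z] tangent_gap_nonneg[OF p]
          by (intro add_left_mono mult_left_mono mult_right_mono) auto
        finally show "cmod (w z) \<le> \<delta> + C / m * (W z * tangent_gap p (w z))" .
      qed
      also have "\<dots> = circle_mean (\<lambda>z. \<delta>) (radius n) + C / m * G n"
        unfolding G_def circle_mean_cmult[symmetric]
        by (intro circle_mean_add radius_in continuous_intros continuous_on_tangent_gap cw cW p0)
      finally show ?thesis by (simp add: circle_mean_const)
    qed
    have "eventually (\<lambda>n. cmod z < radius n) sequentially"
      using z by (intro order_tendstoD(1)[OF radius_tendsto]) auto
    then have "eventually (\<lambda>n. (radius n - cmod z) * cmod (w z) \<le> \<delta> + C / m * G n) sequentially"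
    proof eventually_elim
      case (elim n)
      then show ?case
        using order_trans[OF holomorphic_le_circle_mean[OF wh _ _ elim] mean_w] radius_in[of n] by simp
    qed
    moreover have "(\<lambda>n. (radius n - cmod z) * cmod (w z)) \<longlonglongrightarrow> (1 - cmod z) * cmod (w z)"
      by (intro tendsto_intros radius_tendsto)
    moreover have "(\<lambda>n. \<delta> + C / m * G n) \<longlonglongrightarrow> \<delta> + C / m * 0"
      by (intro tendsto_intros limG)
    ultimately have "(1 - cmod z) * cmod (w z) \<le> \<delta> + C / m * 0"
      by (intro tendsto_le[OF trivial_limit_sequentially])
    then show ?thesis by simp
  qed
  then have "(1 - cmod z) * cmod (w z) \<le> 0" by (rule field_le_epsilon)
  then have "w z = 0" using z by (simp add: mult_le_0_iff)
  then show "J z * k z = 0" using F0[OF z] by (simp add: w_def)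
qed

lemma inner_constant:
  assumes J: "inner_function J" and 1: "1 \<le> cmod (J 0)" and z: "z \<in> ball 0 1"
  shows "J z = J 0"
proof -
  have "J constant_on ball 0 1"
  proof (rule maximum_modulus_principle[OF inner_holomorphic[OF J]])
    show "cmod (J z) \<le> cmod (J 0)" if "z \<in> ball 0 1" for z
      using inner_norm_le_1[OF J that] 1 by simp
  qed auto
  then show ?thesis using z by (auto simp: constant_on_def)
qed

text \<open>
The minimiser has the form \<open>exp \<circ> U \<circ> J\<close> also when \<open>\<bar>J 0\<bar> = 1\<close>: then \<open>U\<close> is a constant logarithm of
\<open>1 / J 0\<close>. This common form is all that the invariant subspaces and the outer property depend on.
\<close>

theorem extremal_problem:
  assumes p: "1 < p" and J: "inner_function J" and J0: "J 0 \<noteq> 0"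
  obtains S U where "open S" "cball 0 1 \<subseteq> S" "U holomorphic_on S"
    "hardy_norm p (\<lambda>z. 1 - J z * exp (U (J z))) = (1 - (cmod (J 0))\<^sup>2) powr (1 / p)"
    "\<forall>k\<in>hardy_space p. (1 - (cmod (J 0))\<^sup>2) powr (1 / p) \<le> hardy_norm p (\<lambda>z. 1 - J z * k z)"
    "\<forall>k\<in>hardy_space p. hardy_norm p (\<lambda>z. 1 - J z * k z) = (1 - (cmod (J 0))\<^sup>2) powr (1 / p) \<longrightarrow>
      (\<forall>z\<in>ball 0 1. k z = exp (U (J z)))"
proof -
  define a where "a = J 0"
  have p0: "0 < p" using p by simp
  have Jh: "J holomorphic_on ball 0 1" by (rule inner_holomorphic[OF J])
  have a1: "cmod a \<le> 1" using inner_norm_le_1[OF J, of 0] by (simp add: a_def)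
  have space: "(\<lambda>z. 1 - J z * k z) \<in> hardy_space p" if "k \<in> hardy_space p" for k
    using hardy_space_diff[OF p bounded_imp_hardy_space[OF p0, of "\<lambda>_. 1" 1]
        hardy_space_bounded_mult[OF p0 Jh inner_norm_le_1[OF J] that]]
    by simp
  show thesis
  proof (cases "cmod a < 1")
    case False
    then have a: "cmod a = 1" using a1 by simp
    have Ja: "J z = a" if "z \<in> ball 0 1" for z
      using inner_constant[OF J _ that] a by (simp add: a_def)
    have e: "a * exp (Ln (1 / a)) = 1" using J0 by (simp add: a_def)
    have "hardy_norm p (\<lambda>z. 1 - J z * exp (Ln (1 / a))) \<le> 0"
    proof (rule hardy_norm_le_bound[OF p0])
      show "(\<lambda>z. 1 - J z * exp (Ln (1 / a))) holomorphic_on ball 0 1" by (intro holomorphic_intros Jh)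
    qed (simp add: Ja e)
    then have n0: "hardy_norm p (\<lambda>z. 1 - J z * exp (Ln (1 / a))) = 0"
      using hardy_norm_nonneg by (rule antisym)
    show thesis
    proof (rule that[of UNIV "\<lambda>_. Ln (1 / a)"], unfold a_def[symmetric], safe)
      fix k and z :: complex assume k: "k \<in> hardy_space p" and z: "z \<in> ball 0 1"
        and "hardy_norm p (\<lambda>z. 1 - J z * k z) = (1 - (cmod a)\<^sup>2) powr (1 / p)"
      then have "1 - J z * k z = 0" using a by (intro hardy_norm_eq_0[OF p space[OF k] _ z]) simp
      then have "a * k z = a * exp (Ln (1 / a))" using e by (simp add: Ja[OF z])
      moreover have "a \<noteq> 0" using a by auto
      ultimately show "k z = exp (Ln (1 / a))" by (metis mult_left_cancel)
    next
      show "hardy_norm p (\<lambda>z. 1 - J z * exp (Ln (1 / a))) = (1 - (cmod a)\<^sup>2) powr (1 / p)"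
        unfolding n0 a by simp
      fix k
      show "(1 - (cmod a)\<^sup>2) powr (1 / p) \<le> hardy_norm p (\<lambda>z. 1 - J z * k z)"
        unfolding a using hardy_norm_nonneg by simp
    qed simp_all
  next
    case True
    define q where "q = 2 / p"
    have q: "0 < q" "q < 2" using p by (auto simp: q_def field_simps)
    have a0: "a \<noteq> 0" using J0 by (simp add: a_def)
    obtain S U where S: "open S" "cball 0 1 \<subseteq> S" "U holomorphic_on S"
      and U: "\<forall>w\<in>S. w * exp (U w) = 1 - exp (of_real q * Ln (1 - cnj a * w))"
      using extremal_generator[OF a0 True q] by blast
    define h where "h z = exp (U (J z))" for z
    define F where "F z = 1 - J z * h z" for z
    have JS: "J z \<in> S" if "z \<in> ball 0 1" for z
      using inner_norm_le_1[OF J that] S(2) by (auto simp: subset_iff)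
    have F_eq: "F z = exp (of_real q * Ln (1 - cnj a * J z))" if "z \<in> ball 0 1" for z
      using bspec[OF U JS[OF that]] by (simp add: F_def h_def)
    have hr: "bounded_with_radial_limits h"
      unfolding h_def[abs_def]
      by (rule inner_compose_radial_limits[OF J _ S(1,2), of "\<lambda>w. exp (U w)"])
         (intro holomorphic_intros S)
    then have hs: "h \<in> hardy_space p" and hh: "h holomorphic_on ball 0 1"
      using bounded_with_radial_limits_bound[OF hr] bounded_imp_hardy_space[OF p0] by metis+
    have Fh: "F holomorphic_on ball 0 1"
      unfolding F_def[abs_def] by (intro holomorphic_intros Jh hh)
    have Fp: "cmod (F z) powr p = (cmod (1 - cnj a * J z))\<^sup>2" if z: "z \<in> ball 0 1" for z
    proof -
      have nz: "0 < cmod (1 - cnj a * J z)"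
        using order_less_le_trans[OF _ inner_weight_pos(1)[OF J _ z], of 0] True unfolding a_def by simp
      have "cmod (F z) = exp (q * ln (cmod (1 - cnj a * J z)))" using nz by (simp add: F_eq[OF z])
      then have "cmod (F z) powr p = exp (2 * ln (cmod (1 - cnj a * J z)))"
        using p0 by (simp add: powr_def q_def)
      then show ?thesis using nz by (simp add: exp_double)
    qed
    have upper: "hardy_norm p F \<le> (1 - (cmod a)\<^sup>2) powr (1 / p)"
    proof (rule hardy_norm_le[OF p0 powr_ge_zero])
      fix r :: real assume r: "r \<in> {0<..<1}"
      \<comment> \<open>The means of \<open>W\<close> are bounded on every circle because \<open>J\<close> is bounded by \<open>1\<close>.\<close>
      have "hardy_mean p F r = circle_mean (\<lambda>z. (cmod (1 - cnj a * J z))\<^sup>2) r"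
        unfolding hardy_mean_eq_circle_mean by (rule circle_mean_cong[OF r Fp])
      also have "\<dots> = 1 - 2 * (cmod a)\<^sup>2 + (cmod a)\<^sup>2 * circle_mean (\<lambda>z. (cmod (J z))\<^sup>2) r"
        unfolding a_def by (rule circle_mean_weight[OF Jh r])
      also have "circle_mean (\<lambda>z. (cmod (J z))\<^sup>2) r \<le> circle_mean (\<lambda>z. 1) r"
        using inner_norm_le_1[OF J] holomorphic_on_imp_continuous_on[OF Jh]
        by (intro circle_mean_mono r continuous_intros power_le_one) auto
      finally have "hardy_mean p F r \<le> 1 - (cmod a)\<^sup>2"
        by (simp add: circle_mean_const mult_left_mono)
      moreover have "0 \<le> 1 - (cmod a)\<^sup>2" using a1 by (simp add: power_le_one)
      ultimately show "hardy_mean p F r \<le> ((1 - (cmod a)\<^sup>2) powr (1 / p)) powr p"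
        using p0 by (simp add: powr_powr)
    qed
    have diff: "(\<lambda>z. k z - h z) \<in> hardy_space p" if "k \<in> hardy_space p" for k
      by (rule hardy_space_diff[OF p that hs])
    have rew: "(\<lambda>z. F z - J z * (k z - h z)) = (\<lambda>z. 1 - J z * k z)" for k
      by (simp add: F_def fun_eq_iff algebra_simps)
    have lower: "1 - (cmod a)\<^sup>2 \<le> hardy_norm p (\<lambda>z. 1 - J z * k z) powr p" if "k \<in> hardy_space p" for k
      using extremal_lower_bound[OF J p diff[OF that] a_def True Fh Fp] space[OF that] unfolding rew by blast
    have d: "((1 - (cmod a)\<^sup>2) powr (1 / p)) powr p = 1 - (cmod a)\<^sup>2"
      using p0 True by (simp add: powr_powr power_le_one)
    have lower': "(1 - (cmod a)\<^sup>2) powr (1 / p) \<le> hardy_norm p (\<lambda>z. 1 - J z * k z)"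
      if "k \<in> hardy_space p" for k
    proof -
      have "(1 - (cmod a)\<^sup>2) powr (1 / p) \<le> (hardy_norm p (\<lambda>z. 1 - J z * k z) powr p) powr (1 / p)"
        using lower[OF that] p0 True by (intro powr_mono2) (auto simp: power_le_one)
      then show ?thesis using p0 hardy_norm_nonneg by (simp add: powr_powr)
    qed
    show thesis
    proof (rule that[OF S], unfold a_def[symmetric], safe)
      show "hardy_norm p (\<lambda>z. 1 - J z * exp (U (J z))) = (1 - (cmod a)\<^sup>2) powr (1 / p)"
        using upper lower'[OF hs] unfolding F_def h_def by (rule antisym)
      fix k assume k: "k \<in> hardy_space p"
      then show "(1 - (cmod a)\<^sup>2) powr (1 / p) \<le> hardy_norm p (\<lambda>z. 1 - J z * k z)"
        by (rule lower')
      fix z :: complex assume z: "z \<in> ball 0 1"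
      assume "hardy_norm p (\<lambda>z. 1 - J z * k z) = (1 - (cmod a)\<^sup>2) powr (1 / p)"
      then have "hardy_norm p (\<lambda>z. 1 - J z * k z) powr p = 1 - (cmod a)\<^sup>2" using d by simp
      then have "J z * (k z - h z) = 0" if "z \<in> ball 0 1" for z
        using extremal_unique[OF J p diff[OF k] a_def True Fh Fp _ _ that] space[OF k] unfolding rew by blast
      moreover have "(\<lambda>z. k z - h z) holomorphic_on ball 0 1" using diff[OF k] by (simp add: hardy_space_def)
      ultimately have "k z - h z = 0"
        using holomorphic_mult_eq_0[OF Jh _ J0 _ z] by blast
      then show "k z = exp (U (J z))" by (simp add: h_def)
    qed
  qed
qed

theorem theorem3p3:
  fixes p :: real and J h :: "complex \<Rightarrow> complex"
  assumes "1 < p"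
    and "inner_function J"
    and "J 0 \<noteq> 0"
    and "h \<in> hardy_space p"
    and "hardy_norm p (\<lambda>z. 1 - J z * h z) =
           (INF g\<in>hardy_space p. hardy_norm p (\<lambda>z. 1 - J z * g z))"
  shows "shift_invariant_hull p (\<lambda>z. J z * h z) = shift_invariant_hull p J \<and>
    outer_function h \<and>
    hardy_dist p (\<lambda>z. 1) (shift_invariant_hull p J) = (1 - (cmod (J 0))\<^sup>2) powr (1 / p)"
proof -
  note p = assms(1) and J = assms(2)
  have p0: "0 < p" using p by simp
  define d where "d = (1 - (cmod (J 0))\<^sup>2) powr (1 / p)"
  obtain S U where S: "open S" "cball 0 1 \<subseteq> S" "U holomorphic_on S"
    and att: "hardy_norm p (\<lambda>z. 1 - J z * exp (U (J z))) = d"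
    and lower: "\<forall>k\<in>hardy_space p. d \<le> hardy_norm p (\<lambda>z. 1 - J z * k z)"
    and unique: "\<forall>k\<in>hardy_space p. hardy_norm p (\<lambda>z. 1 - J z * k z) = d \<longrightarrow>
      (\<forall>z\<in>ball 0 1. k z = exp (U (J z)))"
    using extremal_problem[OF p J assms(3), folded d_def] by blast
  have e: "bounded_with_radial_limits (\<lambda>z. exp (U (J z)))"
    by (rule inner_compose_radial_limits[OF J _ S(1,2), of "\<lambda>w. exp (U w)"]) (intro holomorphic_intros S)
  have e': "bounded_with_radial_limits (\<lambda>z. exp (- U (J z)))"
    by (rule inner_compose_radial_limits[OF J _ S(1,2), of "\<lambda>w. exp (- U w)"]) (intro holomorphic_intros S)
  have u: "bounded_with_radial_limits (\<lambda>z. U (J z))"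
    by (rule inner_compose_radial_limits[OF J S(3,1,2)])
  have es: "(\<lambda>z. exp (U (J z))) \<in> hardy_space p"
    using bounded_with_radial_limits_bound[OF e] bounded_imp_hardy_space[OF p0] by metis
  have "(INF g\<in>hardy_space p. hardy_norm p (\<lambda>z. 1 - J z * g z)) = d"
    by (rule cInf_eq_minimum) (use es att lower in \<open>force+\<close>)
  then have h: "h z = exp (U (J z))" if "z \<in> ball 0 1" for z
    using unique assms(4,5) that by simp
  have Ji: "J \<in> hardy_infinity" using J by (simp add: inner_function_def)

  have "bounded_with_radial_limits J"
    using inner_compose_radial_limits[OF J, of "\<lambda>w. w" UNIV] by simp
  then have "(\<lambda>z. J z * exp (U (J z))) \<in> hardy_infinity"
    using bounded_with_radial_limits_mult[OF _ e] by (simp add: bounded_with_radial_limits_def)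
  moreover have "(\<lambda>z. J z * h z) ` ball 0 1 = (\<lambda>z. J z * exp (U (J z))) ` ball 0 1"
    by (rule image_cong) (simp_all add: h)
  moreover have "(\<lambda>z. J z * h z) holomorphic_on ball 0 1"
    using assms(4) inner_holomorphic[OF J] by (auto simp: hardy_space_def intro!: holomorphic_intros)
  ultimately have Jhi: "(\<lambda>z. J z * h z) \<in> hardy_infinity" by (simp add: hardy_infinity_def)
  have "shift_invariant_hull p (\<lambda>z. J z * h z) \<subseteq> shift_invariant_hull p J"
    by (rule hull_mono_multiplier[OF p e Ji]) (simp add: h)
  moreover have "shift_invariant_hull p J \<subseteq> shift_invariant_hull p (\<lambda>z. J z * h z)"
    by (rule hull_mono_multiplier[OF p e' Jhi]) (simp add: h exp_minus)
  moreover have "outer_function h" by (rule outer_function_exp[OF u h])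
  moreover have "hardy_dist p (\<lambda>z. 1) (shift_invariant_hull p J) = d"
    unfolding hardy_dist_def
  proof (rule cInf_eq_minimum)
    have "(\<lambda>z. exp (U (J z)) * J z) \<in> shift_invariant_hull p J"
      by (rule multiplier_mem_hull[OF p e Ji])
    then show "d \<in> (\<lambda>g. hardy_norm p (\<lambda>z. 1 - g z)) ` shift_invariant_hull p J"
      using att by (intro image_eqI) (simp_all add: mult.commute)
  next
    fix x assume "x \<in> (\<lambda>g. hardy_norm p (\<lambda>z. 1 - g z)) ` shift_invariant_hull p J"
    then obtain g where g: "g \<in> shift_invariant_hull p J" and x: "x = hardy_norm p (\<lambda>z. 1 - g z)"
      by blast
    have gs: "g \<in> hardy_space p" using g by (simp add: mem_shift_invariant_hull_iff)
    show "d \<le> x"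
    proof (rule field_le_epsilon)
      fix \<epsilon> :: real assume "0 < \<epsilon>"
      then obtain P where P: "hardy_norm p (\<lambda>z. g z - poly P z * J z) < \<epsilon>"
        using g by (auto simp: mem_shift_invariant_hull_iff)
      have PJ: "(\<lambda>z. poly P z * J z) \<in> hardy_space p"
        using multiplier_mem_hull[OF p bounded_with_radial_limits_poly Ji]
        by (simp add: mem_shift_invariant_hull_iff)
      have Ps: "poly P \<in> hardy_space p"
        using bounded_with_radial_limits_bound[OF bounded_with_radial_limits_poly[of P]]
          bounded_imp_hardy_space[OF p0] by metis
      have one: "(\<lambda>z. 1) \<in> hardy_space p"
        by (rule bounded_imp_hardy_space[OF p0, where C = 1]) auto
      have "d \<le> hardy_norm p (\<lambda>z. 1 - J z * poly P z)" by (rule bspec[OF lower Ps])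
      also have "\<dots> = hardy_norm p (\<lambda>z. (1 - g z) + (g z - poly P z * J z))"
        by (simp add: mult.commute)
      also have "\<dots> \<le> x + hardy_norm p (\<lambda>z. g z - poly P z * J z)"
        unfolding x by (intro hardy_norm_triangle hardy_space_diff p one gs PJ)
      finally show "d \<le> x + \<epsilon>" using P by simp
    qed
  qed
  ultimately show ?thesis by (auto simp: d_def)
qed

end
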